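(* Let $n\ge1$ and let $f:\mathbb{R}^{n}\to(-1,1)$ be smooth. For each $x\in\mathbb{R}^n$ let $r=r(x)\ge 0$ be the unique nonnegative solution of the equation $$\|\nabla f(x)\|^{2}=r\,\bigl(e^{r}-f(x)^{2}\bigr).$$ Then $$\int_{\mathbb{R}^{n}}\left[f\arccos\bigl(-f e^{-r/2}\bigr)+(1-r)\sqrt{e^{r}-f^{2}}\right]d\gamma\;\leq\;\left(\int_{\mathbb{R}^{n}} f\,d\gamma\right)\arccos\left(-\int_{\mathbb{R}^{n}} f\,d\gamma\right)+\sqrt{1-\left(\int_{\mathbb{R}^{n}} f\,d\gamma\right)^{2}}.$$
   Context: $d\gamma(x)=\frac{1}{\sqrt{(2\pi)^{n}}}e^{-|x|^{2}/2}\,dx$ is the standard Gaussian measure on $\mathbb{R}^n$, and $\|\nabla f\|$ is the Euclidean norm of the gradient. *)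

theory Defs
  imports "HOL-Analysis.Analysis"
begin

primrec times_differentiable :: "nat \<Rightarrow> ('a::real_normed_vector \<Rightarrow> real) \<Rightarrow> bool" where
  "times_differentiable 0 f \<longleftrightarrow> continuous_on UNIV f"
| "times_differentiable (Suc k) f \<longleftrightarrow>
     (\<forall>x. f differentiable (at x)) \<and>
     (\<forall>v. times_differentiable k (\<lambda>x. frechet_derivative f (at x) v))"

definition smooth :: "('a::real_normed_vector \<Rightarrow> real) \<Rightarrow> bool" where
  "smooth f \<longleftrightarrow> (\<forall>k. times_differentiable k f)"

definition gradient :: "('a::euclidean_space \<Rightarrow> real) \<Rightarrow> 'a \<Rightarrow> 'a" where
  "gradient f x = (THE D. GDERIV f x :> D)"

lemma gderiv_gradient:
  fixes f :: "'a::euclidean_space \<Rightarrow> real"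
  assumes "f differentiable (at x)"
  shows "GDERIV f x :> gradient f x"
proof -
  obtain f' where f': "(f has_derivative f') (at x)"
    using assms unfolding differentiable_def by blast
  then interpret linear f' by (rule has_derivative_linear)
  define D where "D = (\<Sum>i\<in>Basis. f' i *\<^sub>R i)"
  have "f' = (\<lambda>h. h \<bullet> D)"
  proof
    fix h
    have "f' h = f' (\<Sum>i\<in>Basis. (h \<bullet> i) *\<^sub>R i)"
      by (simp add: euclidean_representation)
    also have "\<dots> = (\<Sum>i\<in>Basis. (h \<bullet> i) * f' i)"
      by (simp add: sum scale)
    also have "\<dots> = h \<bullet> D"
      by (simp add: D_def inner_sum_right mult.commute)
    finally show "f' h = h \<bullet> D" .
  qed
  then have D: "GDERIV f x :> D"
    using f' unfolding gderiv_def by simp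
  have "E = D" if "GDERIV f x :> E" for E
  proof -
    have "(\<lambda>h. h \<bullet> E) = (\<lambda>h. h \<bullet> D)"
      using that D unfolding gderiv_def by (rule has_derivative_unique)
    then have "\<forall>h. h \<bullet> E = h \<bullet> D"
      by (simp add: fun_eq_iff)
    then show ?thesis
      by (simp add: vector_eq_ldot)
  qed
  then show ?thesis
    unfolding gradient_def using D by (rule theI[rotated])
qed

definition gaussian_measure :: "(real ^ 'n) measure" where
  "gaussian_measure =
     density lborel
       (\<lambda>x. ennreal (1 / sqrt ((2 * pi) ^ CARD('n)) * exp (- (norm x)\<^sup>2 / 2)))"

definition radial_sol :: "('a::euclidean_space \<Rightarrow> real) \<Rightarrow> 'a \<Rightarrow> real" where
  "radial_sol f x =
     (THE r. 0 \<le> r \<and> (norm (gradient f x))\<^sup>2 = r * (exp r - (f x)\<^sup>2))"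

lemma radial_sol_unique:
  fixes t y :: real
  assumes "\<bar>t\<bar> < 1"
  shows "\<exists>!r. 0 \<le> r \<and> y\<^sup>2 = r * (exp r - t\<^sup>2)"
proof -
  define g where "g r = r * (exp r - t\<^sup>2)" for r :: real
  have t: "t\<^sup>2 < 1"
    using assms by (simp add: abs_square_less_1)
  have mono: "g a < g b" if "0 \<le> a" "a < b" for a b
  proof -
    have "1 \<le> exp a" "exp a < exp b"
      using that by auto
    then have "0 < exp a - t\<^sup>2" "exp a - t\<^sup>2 < exp b - t\<^sup>2"
      using t by linarith+
    then show ?thesis
      unfolding g_def using that by (intro mult_strict_mono') auto
  qed
  have "y\<^sup>2 \<le> g (1 + y\<^sup>2)"
  proof -
    have "1 + (1 + y\<^sup>2) \<le> exp (1 + y\<^sup>2)"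
      by (rule exp_ge_add_one_self)
    then have "1 \<le> exp (1 + y\<^sup>2) - t\<^sup>2"
      using t zero_le_power2[of y] by linarith
    then have "(1 + y\<^sup>2) * 1 \<le> g (1 + y\<^sup>2)"
      unfolding g_def by (intro mult_left_mono) auto
    then show ?thesis by simp
  qed
  moreover have "g 0 \<le> y\<^sup>2"
    by (simp add: g_def)
  moreover have "continuous_on {0..1 + y\<^sup>2} g"
    unfolding g_def by (intro continuous_intros)
  ultimately obtain r where r: "0 \<le> r" "g r = y\<^sup>2"
    using IVT'[of g 0 "y\<^sup>2" "1 + y\<^sup>2"] by auto
  have "\<exists>!r. 0 \<le> r \<and> y\<^sup>2 = g r"
  proof (rule ex1I)
    show "0 \<le> r \<and> y\<^sup>2 = g r"
      using r by simp
    show "s = r" if "0 \<le> s \<and> y\<^sup>2 = g s" for s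
      using that r mono[of r s] mono[of s r] by linarith
  qed
  then show ?thesis
    by (simp only: g_def)
qed

(* The Lebesgue integral with values in [-\<infinity>,\<infinity>]. The Bochner integral would give 0 on
   a function whose negative part alone has infinite integral. A function whose positive and
   negative parts both have infinite integral gets the value \<infinity>, because
   \<infinity> - \<infinity> = \<infinity> in ereal. *)
definition extended_integral :: "'a measure \<Rightarrow> ('a \<Rightarrow> real) \<Rightarrow> ereal" where
  "extended_integral M g =
     enn2ereal (\<integral>\<^sup>+ x. ennreal (g x) \<partial>M) - enn2ereal (\<integral>\<^sup>+ x. ennreal (- g x) \<partial>M)"

lemma extended_integral_eq_integral:
  assumes "integrable M g"
  shows "extended_integral M g = ereal (\<integral>x. g x \<partial>M)"
proof -
  have fin: "(\<integral>\<^sup>+ x. ennreal (g x) \<partial>M) \<noteq> \<infinity>" "(\<integral>\<^sup>+ x. ennreal (- g x) \<partial>M) \<noteq> \<infinity>"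
    using assms by (simp_all add: real_integrable_def)
  have *: "enn2ereal a = ereal (enn2real a)" if "a \<noteq> \<infinity>" for a
    using that by (cases a) simp_all
  show ?thesis
    unfolding extended_integral_def real_lebesgue_integral_def[OF assms]
    by (simp only: *[OF fin(1)] *[OF fin(2)] ereal_minus)
qed

end

(*
Write the integrand as M(f, |grad f|^2). The partial derivatives of M are theta = arccos (-f e^(-r/2))
and -1/(2S) with S = sqrt (e^r - f^2). Let P be the Ornstein-Uhlenbeck semigroup. The integral of
M(P f, |grad P f|^2) increases along the semigroup from the left-hand side to M(m, 0), which is the
right-hand side: Gaussian integration by parts turns its derivative into the integral of a quadratic
form in the second derivatives of P f, and by Cauchy-Schwarz this form is bounded below by a sum of
the squares (beta + r a alpha)^2 up to positive factors (alpha = D_i P f, beta = grad P f . D_i grad P f,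
a = P f).

This is carried out for f with |f| <= c < 1 and bounded derivatives. A general f is multiplied by
max(0, 1 - |x|^2/R^2)^4, which is C^3, all that the argument needs; |M| at the truncation is at most
C + C |M|, so that dominated convergence applies whenever M(f, |grad f|^2) is integrable. If it is not,
the left-hand side is minus infinity, as M is bounded above.
*)

theory Submission
  imports Defs "HOL-Probability.Probability"
begin

text \<open>The semigroup is parametrised by an angle \<open>s\<close> in [0, pi/2], the time being
  -ln (cos s). Both endpoint values are given by the averaging formula itself, so no limit at
  infinite time arises. The \<open>s\<close>-derivative is tan s times the generator, but every
  spatial derivative of \<open>mehler s\<close> brings out a factor cos s, so the formulas stay
  regular at pi/2.

  The time derivative of grad P f contains third derivatives of f. They cancel only after the drift
  term has been integrated by parts against a field \<open>H\<close> for which cos s *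
  \<open>H\<close> is the spatial gradient of M(P f, |grad P f|^2).

  The bound c < 1 keeps S at least sqrt (1 - c^2). All quotients are then bounded uniformly in
  \<open>s\<close> and x, and domination reduces to linear growth in x.

  The gradient may vanish, which puts (f, |grad f|^2) on the boundary w = 0 of the domain of M, with
  r = 0. Hence r is differentiated along curves that stay in w >= 0, not by an implicit function
  theorem on an open set, and the quadratic form, whose lower bound divides by r, has a separate
  case.\<close>

section \<open>Gaussian measure and integration by parts\<close>

text \<open>Dominated convergence along sequences: the mean value inequality bounds each difference
  quotient by \<open>C\<close>. Measurability of \<open>F' t\<close> is derived on the way, as it is
  a pointwise limit of measurable difference quotients.\<close>

lemma has_real_derivative_integral:
  fixes F :: "real \<Rightarrow> 'a \<Rightarrow> real"
  assumes I: "open I" "t \<in> I"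
    and int: "\<And>s. s \<in> I \<Longrightarrow> integrable M (F s)"
    and der: "\<And>s x. s \<in> I \<Longrightarrow> ((\<lambda>s. F s x) has_real_derivative F' s x) (at s)"
    and bound: "\<And>s x. s \<in> I \<Longrightarrow> \<bar>F' s x\<bar> \<le> C x"
    and C: "integrable M C"
  shows "((\<lambda>s. \<integral>x. F s x \<partial>M) has_real_derivative (\<integral>x. F' t x \<partial>M)) (at t)"
proof -
  obtain e where e: "e > 0" "ball t e \<subseteq> I"
    using I open_contains_ball by blast
  have [measurable]: "F s \<in> borel_measurable M" if "s \<in> I" for s
    using int[OF that] by auto
  have "((\<lambda>s. ((\<integral>x. F s x \<partial>M) - (\<integral>x. F t x \<partial>M)) / (s - t)) \<longlongrightarrow> (\<integral>x. F' t x \<partial>M)) (at t)"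
    unfolding tendsto_at_iff_sequentially comp_def
  proof (intro allI impI)
    fix X :: "nat \<Rightarrow> real"
    assume X: "\<forall>i. X i \<in> UNIV - {t}" "X \<longlonglongrightarrow> t"
    have "\<forall>\<^sub>F n in sequentially. X n \<in> ball t e"
      using X(2) e(1) by (auto simp: tendsto_iff dist_commute)
    then obtain N where N: "\<And>n. n \<ge> N \<Longrightarrow> X n \<in> ball t e"
      by (auto simp: eventually_sequentially)
    define Y where "Y n = X (n + N)" for n
    have Y: "Y n \<in> ball t e" "Y n \<in> I" "Y n \<noteq> t" for n
      using N[of "n + N"] e X(1) by (auto simp: Y_def)
    have tI: "t \<in> I" by fact
    have Ylim: "Y \<longlonglongrightarrow> t"
      unfolding Y_def by (rule LIMSEQ_ignore_initial_segment[OF X(2)])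
    have lim: "(\<lambda>n. (F (Y n) x - F t x) / (Y n - t)) \<longlonglongrightarrow> F' t x" for x
    proof -
      have "((\<lambda>s. (F s x - F t x) / (s - t)) \<longlongrightarrow> F' t x) (at t)"
        using der[OF tI, of x] by (simp add: has_field_derivative_iff)
      then show ?thesis
        unfolding tendsto_at_iff_sequentially comp_def using Y(3) Ylim by auto
    qed
    have bnd: "\<bar>(F (Y n) x - F t x) / (Y n - t)\<bar> \<le> C x" for n x
    proof -
      have "\<bar>F (Y n) x - F t x\<bar> \<le> C x * \<bar>Y n - t\<bar>"
      proof -
        have "norm (F (Y n) x - F t x) \<le> C x * norm (Y n - t)"
        proof (rule field_differentiable_bound[where S="ball t e" and f'="\<lambda>s. F' s x"])
          show "((\<lambda>s. F s x) has_field_derivative F' s x) (at s within ball t e)" if "s \<in> ball t e" for s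
            by (rule has_field_derivative_at_within, rule der) (use that e(2) in blast)
          show "norm (F' s x) \<le> C x" if "s \<in> ball t e" for s
            using bound[of s x] that e(2) by auto
        qed (use Y e in auto)
        then show ?thesis by simp
      qed
      then show ?thesis
        using Y(3)[of n] by (simp add: divide_simps)
    qed
    have m: "(\<lambda>x. (F (Y n) x - F t x) / (Y n - t)) \<in> borel_measurable M" for n
      using Y(2)[of n] tI by measurable
    have m': "F' t \<in> borel_measurable M"
      by (rule borel_measurable_LIMSEQ_real[OF lim m])
    have "(\<lambda>n. \<integral>x. (F (Y n) x - F t x) / (Y n - t) \<partial>M) \<longlonglongrightarrow> (\<integral>x. F' t x \<partial>M)"
      by (rule integral_dominated_convergence[OF m' m C]) (use lim bnd in auto)
    also have "(\<lambda>n. \<integral>x. (F (Y n) x - F t x) / (Y n - t) \<partial>M) =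
        (\<lambda>n. ((\<integral>x. F (Y n) x \<partial>M) - (\<integral>x. F t x \<partial>M)) / (Y n - t))"
      using int Y(2) tI by (auto simp: fun_eq_iff)
    finally show "(\<lambda>n. ((\<integral>x. F (X n) x \<partial>M) - (\<integral>x. F t x \<partial>M)) / (X n - t)) \<longlonglongrightarrow> (\<integral>x. F' t x \<partial>M)"
      unfolding Y_def by (rule LIMSEQ_offset[where k=N])
  qed
  then show ?thesis
    by (simp add: has_field_derivative_iff)
qed

text \<open>The exponential factorises over the basis into one-dimensional normal densities. The
  variance is kept general for two uses: 1 gives the total mass of the Gaussian measure, and 2 gives
  the wider Gaussian that dominates an exponential moment.\<close>

lemma nn_integral_exp_neg_sq_norm:
  assumes "\<sigma> > 0"
  shows "(\<integral>\<^sup>+x. ennreal (exp (- (norm (x::'a))\<^sup>2 / (2 * \<sigma>\<^sup>2))) \<partial>lborel) =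
    ennreal (sqrt (2 * pi * \<sigma>\<^sup>2) ^ DIM('a::euclidean_space))"
proof -
  have one: "(\<integral>\<^sup>+t. ennreal (exp (- t\<^sup>2 / (2 * \<sigma>\<^sup>2))) \<partial>lborel) = ennreal (sqrt (2 * pi * \<sigma>\<^sup>2))"
  proof -
    have eq: "exp (- t\<^sup>2 / (2 * \<sigma>\<^sup>2)) = sqrt (2 * pi * \<sigma>\<^sup>2) * normal_density 0 \<sigma> t" for t
      using assms by (simp add: normal_density_def)
    have "has_bochner_integral lborel (\<lambda>t. exp (- t\<^sup>2 / (2 * \<sigma>\<^sup>2))) (sqrt (2 * pi * \<sigma>\<^sup>2))"
      unfolding eq has_bochner_integral_iff using assms by simp
    then show ?thesis
      by (subst nn_integral_eq_integral) (auto simp: has_bochner_integral_iff)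
  qed
  have "(\<integral>\<^sup>+x. ennreal (exp (- (norm (x::'a))\<^sup>2 / (2 * \<sigma>\<^sup>2))) \<partial>lborel) =
    (\<integral>\<^sup>+x. (\<Prod>b\<in>(Basis::'a set). ennreal (exp (- (x \<bullet> b)\<^sup>2 / (2 * \<sigma>\<^sup>2)))) \<partial>lborel)"
  proof (rule nn_integral_cong)
    fix x :: 'a
    have "exp (- (norm x)\<^sup>2 / (2 * \<sigma>\<^sup>2)) = exp (\<Sum>b\<in>Basis. - (x \<bullet> b)\<^sup>2 / (2 * \<sigma>\<^sup>2))"
      by (simp add: norm_eq_sqrt_inner[of x] euclidean_inner[of x x] sum_divide_distrib sum_negf
          sum_nonneg flip: power2_eq_square)
    then show "ennreal (exp (- (norm x)\<^sup>2 / (2 * \<sigma>\<^sup>2))) =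
        (\<Prod>b\<in>Basis. ennreal (exp (- (x \<bullet> b)\<^sup>2 / (2 * \<sigma>\<^sup>2))))"
      by (simp add: exp_sum prod_ennreal)
  qed
  also have "\<dots> = (\<Prod>b\<in>(Basis::'a set). \<integral>\<^sup>+t. ennreal (exp (- t\<^sup>2 / (2 * \<sigma>\<^sup>2))) \<partial>lborel)"
    by (rule nn_integral_lborel_prod) auto
  also have "\<dots> = ennreal (sqrt (2 * pi * \<sigma>\<^sup>2) ^ DIM('a))"
    by (simp add: one[simplified] prod_ennreal ennreal_power)
  finally show ?thesis .
qed

definition gaussian_density :: "real ^ 'n \<Rightarrow> real" where
  "gaussian_density x = 1 / sqrt ((2 * pi) ^ CARD('n)) * exp (- (norm x)\<^sup>2 / 2)"

lemma gaussian_density_nonneg: "0 \<le> gaussian_density x"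
  by (simp add: gaussian_density_def)

lemma borel_measurable_gaussian_density [measurable]: "gaussian_density \<in> borel_measurable borel"
  unfolding gaussian_density_def by measurable

lemma gaussian_measure_eq: "gaussian_measure = density lborel (\<lambda>x. ennreal (gaussian_density x))"
  by (simp add: gaussian_measure_def gaussian_density_def)

lemma sets_gaussian_measure [simp, measurable_cong]: "sets gaussian_measure = sets borel"
  by (simp add: gaussian_measure_def)

lemma space_gaussian_measure [simp]: "space gaussian_measure = UNIV"
  by (simp add: gaussian_measure_def)

lemma prob_space_gaussian: "prob_space (gaussian_measure :: (real ^ 'n) measure)"
proof
  have "emeasure (gaussian_measure :: (real ^ 'n) measure) UNIV =
     (\<integral>\<^sup>+x. ennreal (1 / sqrt ((2 * pi) ^ CARD('n))) * ennreal (exp (- (norm (x :: real^'n))\<^sup>2 / (2 * 1\<^sup>2))) \<partial>lborel)"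
    unfolding gaussian_measure_def by (subst emeasure_density) (auto simp flip: ennreal_mult)
  also have "\<dots> = ennreal (1 / sqrt ((2 * pi) ^ CARD('n))) * ennreal (sqrt (2 * pi * 1\<^sup>2) ^ DIM(real^'n))"
    by (subst nn_integral_cmult, measurable, subst nn_integral_exp_neg_sq_norm[where 'a="real^'n"]) auto
  also have "\<dots> = 1"
    by (simp add: real_sqrt_power real_sqrt_mult power_mult_distrib flip: ennreal_mult)
  finally show "emeasure (gaussian_measure :: (real ^ 'n) measure) (space gaussian_measure) = 1"
    by simp
qed

lemma integrable_gaussian_bounded:
  fixes h :: "real ^ 'n \<Rightarrow> real"
  assumes "h \<in> borel_measurable borel" "\<And>x. \<bar>h x\<bar> \<le> C"
  shows "integrable gaussian_measure h"
proof -
  interpret prob_space "gaussian_measure :: (real ^ 'n) measure" by (rule prob_space_gaussian)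
  show ?thesis
    by (rule integrable_const_bound[where B=C]) (use assms in auto)
qed

lemma integrable_gaussian_exp_norm:
  "integrable (gaussian_measure :: (real ^ 'n) measure) (\<lambda>x. exp (2 * norm x))"
proof -
  let ?c = "1 / sqrt ((2 * pi) ^ CARD('n)) * exp 4"
  have le: "gaussian_density x * exp (2 * norm x) \<le> ?c * exp (- (norm x)\<^sup>2 / (2 * (sqrt 2)\<^sup>2))" for x :: "real^'n"
  proof -
    \<comment> \<open>Half of the Gaussian exponent absorbs the linear term: |x|^2/4 - 2|x| + 4 is
      this square. The 4 is the source of the factor exp 4 in \<open>?c\<close>, and the other half
      of the exponent is the Gaussian of variance 2.\<close>
    have "0 \<le> (norm x / 2 - 2)\<^sup>2" by simp
    then have "- (norm x)\<^sup>2 / 2 + 2 * norm x \<le> 4 + - (norm x)\<^sup>2 / (2 * (sqrt 2)\<^sup>2)"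
      by (simp add: power2_eq_square field_simps)
    then have "exp (- (norm x)\<^sup>2 / 2 + 2 * norm x) \<le> exp (4 + - (norm x)\<^sup>2 / (2 * (sqrt 2)\<^sup>2))"
      by simp
    then show ?thesis
      unfolding gaussian_density_def mult.assoc exp_add by (intro mult_left_mono) auto
  qed
  have "integrable lborel (\<lambda>x::real^'n. ?c * exp (- (norm x)\<^sup>2 / (2 * (sqrt 2)\<^sup>2)))"
    by (intro integrable_mult_right integrableI_nonneg) 
      (use nn_integral_exp_neg_sq_norm[of "sqrt 2", where 'a="real^'n"] in \<open>auto simp: less_top[symmetric] simp del: ennreal_power\<close>)
  then have "integrable lborel (\<lambda>x::real^'n. gaussian_density x * exp (2 * norm x))"
    by (rule Bochner_Integration.integrable_bound)
      (use le in \<open>auto simp: gaussian_density_nonneg abs_mult intro!: AE_I2\<close>)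
  then show ?thesis
    unfolding gaussian_measure_eq
    by (subst integrable_density) (auto simp: gaussian_density_nonneg)
qed

lemma integrable_gaussian_linear_growth:
  fixes h :: "real ^ 'n \<Rightarrow> real"
  assumes "h \<in> borel_measurable borel" "\<And>x. \<bar>h x\<bar> \<le> C * (1 + norm x)"
  shows "integrable gaussian_measure h"
proof -
  have C: "C \<ge> 0" using assms(2)[of 0] by simp
  have "integrable gaussian_measure (\<lambda>x::real^'n. C * exp (2 * norm x))"
    using integrable_gaussian_exp_norm by (rule integrable_mult_right)
  then show ?thesis
  proof (rule Bochner_Integration.integrable_bound)
    show "h \<in> borel_measurable gaussian_measure" using assms(1) by simp
    have "norm (h x) \<le> norm (C * exp (2 * norm x))" for x
    proof -
      have "1 + norm x \<le> 1 + 2 * norm x" by simp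
      also have "\<dots> \<le> exp (2 * norm x)" by (rule exp_ge_add_one_self)
      finally have "C * (1 + norm x) \<le> C * exp (2 * norm x)"
        using C by (rule mult_left_mono)
      then show ?thesis using assms(2)[of x] C by (simp add: abs_mult)
    qed
    then show "AE x in gaussian_measure. norm (h x) \<le> norm (C * exp (2 * norm x))" by simp
  qed
qed

text \<open>Translation invariance of Lebesgue measure moves the shift onto the density, and
  expanding the square of the shifted norm leaves the exponential weight.\<close>

lemma cameron_martin_axis:
  fixes h :: "real ^ 'n \<Rightarrow> real"
  assumes [measurable]: "h \<in> borel_measurable borel"
  shows "(\<integral>x. h (x + t *\<^sub>R axis i 1) \<partial>gaussian_measure) =
    (\<integral>x. exp (t * x $ i - t\<^sup>2 / 2) * h x \<partial>gaussian_measure)"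
proof -
  let ?e = "axis i 1 :: real^'n"
  have rho: "gaussian_density (x - t *\<^sub>R ?e) = gaussian_density x * exp (t * x $ i - t\<^sup>2 / 2)" for x
  proof -
    have "(norm (x - t *\<^sub>R ?e))\<^sup>2 = (norm x)\<^sup>2 - 2 * t * x $ i + t\<^sup>2"
      unfolding power2_norm_eq_inner
      by (simp add: inner_diff_left inner_diff_right inner_axis inner_axis' algebra_simps power2_eq_square)
    then have "- (norm (x - t *\<^sub>R ?e))\<^sup>2 / 2 = - (norm x)\<^sup>2 / 2 + (t * x $ i - t\<^sup>2 / 2)"
      by (simp add: field_simps)
    then show ?thesis
      unfolding gaussian_density_def by (simp only: exp_add mult.assoc)
  qed
  have "(\<integral>x. h (x + t *\<^sub>R ?e) \<partial>gaussian_measure) =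
      (\<integral>x. gaussian_density x * h (x + t *\<^sub>R ?e) \<partial>lborel)"
    unfolding gaussian_measure_eq by (subst integral_density) (auto simp: gaussian_density_nonneg)
  also have "\<dots> = (\<integral>x. gaussian_density (- (t *\<^sub>R ?e) + x) * h ((- (t *\<^sub>R ?e) + x) + t *\<^sub>R ?e) \<partial>lborel)"
    by (subst (1) lborel_distr_plus[of "- (t *\<^sub>R ?e)", symmetric], subst integral_distr) auto
  also have "\<dots> = (\<integral>x. gaussian_density x * (exp (t * x $ i - t\<^sup>2 / 2) * h x) \<partial>lborel)"
    by (intro Bochner_Integration.integral_cong) (auto simp: rho mult.assoc)
  also have "\<dots> = (\<integral>x. exp (t * x $ i - t\<^sup>2 / 2) * h x \<partial>gaussian_measure)"
    unfolding gaussian_measure_eq by (subst integral_density) (auto simp: gaussian_density_nonneg)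
  finally show ?thesis .
qed

text \<open>Both sides of the Cameron-Martin identity are differentiated at t = 0: the left one
  gives the integral of \<open>h'\<close>, the right one brings down the factor
  \<open>x $ i\<close>. No slicing into lines and no boundary terms arise.\<close>

lemma gaussian_integration_by_parts:
  fixes h :: "real ^ 'n \<Rightarrow> real"
  assumes h [measurable]: "h \<in> borel_measurable borel"
    and bnd: "\<And>x. \<bar>h x\<bar> \<le> C" "\<And>x. \<bar>h' x\<bar> \<le> C'"
    and der: "\<And>x. ((\<lambda>t. h (x + t *\<^sub>R axis i 1)) has_real_derivative h' x) (at 0)"
  shows "(\<integral>x. x $ i * h x \<partial>gaussian_measure) = (\<integral>x. h' x \<partial>gaussian_measure)"
proof -
  let ?e = "axis i 1 :: real^'n"
  have der': "((\<lambda>t. h (x + t *\<^sub>R ?e)) has_real_derivative h' (x + s *\<^sub>R ?e)) (at s)" for x s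
    using der[of "x + s *\<^sub>R ?e"] DERIV_shift[of "\<lambda>t. h (x + t *\<^sub>R ?e)" "h' (x + s *\<^sub>R ?e)" 0 s]
    by (simp add: algebra_simps)
  interpret prob_space "gaussian_measure :: (real ^ 'n) measure" by (rule prob_space_gaussian)
  have C: "C \<ge> 0" using bnd(1)[of 0] by linarith
  have "((\<lambda>t. \<integral>x. h (x + t *\<^sub>R ?e) \<partial>gaussian_measure) has_real_derivative
      (\<integral>x. h' (x + 0 *\<^sub>R ?e) \<partial>gaussian_measure)) (at 0)"
    by (rule has_real_derivative_integral[where I=UNIV and C="\<lambda>_. C'" and F'="\<lambda>s x. h' (x + s *\<^sub>R ?e)"])
       (auto intro!: integrable_gaussian_bounded[where C=C] bnd der')
  moreover have "((\<lambda>t. \<integral>x. exp (t * x $ i - t\<^sup>2 / 2) * h x \<partial>gaussian_measure) has_real_derivative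
      (\<integral>x. (x $ i - 0) * exp (0 * x $ i - 0\<^sup>2 / 2) * h x \<partial>gaussian_measure)) (at 0)"
  \<comment> \<open>For |t| < 1 the weight and the factor |x_i - t| are each at most exp |x|, whence
    the dominating function exp (2|x|).\<close>
  proof (rule has_real_derivative_integral[where I="{-1<..<1}" and C="\<lambda>x. C * exp (2 * norm x)"
        and F'="\<lambda>t x. (x $ i - t) * exp (t * x $ i - t\<^sup>2 / 2) * h x"])
    have le1: "exp (t * x $ i - t\<^sup>2 / 2) \<le> exp (norm x)" if "\<bar>t\<bar> < 1" for t and x :: "real^'n"
    proof -
      have "t * x $ i \<le> \<bar>t\<bar> * \<bar>x $ i\<bar>" by (metis abs_ge_self abs_mult)
      also have "\<dots> \<le> 1 * norm x" using that component_le_norm_cart[of x i] by (intro mult_mono) auto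
      finally have "t * x $ i \<le> norm x" by simp
      moreover have "0 \<le> t\<^sup>2" by simp
      ultimately show ?thesis unfolding exp_le_cancel_iff by linarith
    qed
    have le2: "\<bar>x $ i - t\<bar> \<le> exp (norm x)" if "\<bar>t\<bar> < 1" for t and x :: "real^'n"
      using that component_le_norm_cart[of x i] exp_ge_add_one_self[of "norm x"] by linarith
    have ee: "exp (norm x) * exp (norm x) = exp (2 * norm x)" for x :: "real^'n"
      by (simp flip: exp_add)
    show "integrable gaussian_measure (\<lambda>x. exp (s * x $ i - s\<^sup>2 / 2) * h x)" if "s \<in> {-1<..<1}" for s
    proof (rule Bochner_Integration.integrable_bound)
      show "integrable gaussian_measure (\<lambda>x::real^'n. C * exp (2 * norm x))"
        by (intro integrable_mult_right integrable_gaussian_exp_norm)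
      have "exp (s * x $ i - s\<^sup>2 / 2) * \<bar>h x\<bar> \<le> exp (2 * norm x) * C" for x
      proof (rule mult_mono)
        show "exp (s * x $ i - s\<^sup>2 / 2) \<le> exp (2 * norm x)"
          using le1[of s x] that by (rule_tac order_trans[of _ "exp (norm x)"]) auto
      qed (use bnd C in auto)
      then show "AE x in gaussian_measure. norm (exp (s * x $ i - s\<^sup>2 / 2) * h x) \<le> norm (C * exp (2 * norm x))"
        using C by (auto simp: abs_mult mult.commute)
    qed measurable
    show "\<bar>(x $ i - s) * exp (s * x $ i - s\<^sup>2 / 2) * h x\<bar> \<le> C * exp (2 * norm x)"
      if "s \<in> {-1<..<1}" for s and x :: "real^'n"
    proof -
      have s: "\<bar>s\<bar> < 1" using that by auto
      have "\<bar>x $ i - s\<bar> * exp (s * x $ i - s\<^sup>2 / 2) * \<bar>h x\<bar> \<le> exp (norm x) * exp (norm x) * C"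
        using le1[OF s, of x] le2[OF s, of x] bnd(1)[of x] C by (intro mult_mono) auto
      then show ?thesis by (simp add: abs_mult ee mult.commute)
    qed
    show "((\<lambda>t. exp (t * x $ i - t\<^sup>2 / 2) * h x) has_real_derivative
          (x $ i - s) * exp (s * x $ i - s\<^sup>2 / 2) * h x) (at s)" for s and x :: "real^'n"
      by (auto intro!: derivative_eq_intros)
    show "integrable gaussian_measure (\<lambda>x::real^'n. C * exp (2 * norm x))"
      by (intro integrable_mult_right integrable_gaussian_exp_norm)
  qed auto
  ultimately show ?thesis
    unfolding cameron_martin_axis[OF h] by (auto dest: DERIV_unique)
qed

section \<open>The function in the inequality\<close>

text \<open>The implicit equation with two real variables in place of a function: \<open>a\<close>
  stands for the value and \<open>w\<close> for the squared gradient norm. The square is a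
  polynomial in the partial derivatives and so remains differentiable where the gradient
  vanishes.\<close>

definition rsol :: "real \<Rightarrow> real \<Rightarrow> real" where
  "rsol a w = (THE r. 0 \<le> r \<and> w = r * (exp r - a\<^sup>2))"

definition ssol :: "real \<Rightarrow> real \<Rightarrow> real" where
  "ssol a w = sqrt (exp (rsol a w) - a\<^sup>2)"

definition angle_sol :: "real \<Rightarrow> real \<Rightarrow> real" where
  "angle_sol a w = arccos (- a * exp (- rsol a w / 2))"

text \<open>The function M of the overview; \<open>angle_sol\<close> and \<open>ssol\<close> are its
  theta and S.\<close>

definition bellman :: "real \<Rightarrow> real \<Rightarrow> real" where
  "bellman a w = a * angle_sol a w + (1 - rsol a w) * ssol a w"

lemma radial_sol_eq_rsol: "radial_sol f x = rsol (f x) ((norm (gradient f x))\<^sup>2)"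
  by (simp add: radial_sol_def rsol_def)

lemma rsol_eq:
  assumes "\<bar>a\<bar> < 1" "0 \<le> w"
  shows "0 \<le> rsol a w" "rsol a w * (exp (rsol a w) - a\<^sup>2) = w"
proof -
  have "\<exists>!r. 0 \<le> r \<and> w = r * (exp r - a\<^sup>2)"
    using radial_sol_unique[OF assms(1), of "sqrt w"] assms(2) by simp
  from theI'[OF this] show "0 \<le> rsol a w" "rsol a w * (exp (rsol a w) - a\<^sup>2) = w"
    by (simp_all add: rsol_def)
qed

lemma exp_minus_square_pos:
  assumes "\<bar>a\<bar> < 1" "0 \<le> (r::real)"
  shows "0 < exp r - a\<^sup>2"
proof -
  have "a\<^sup>2 < 1" using assms(1) by (simp add: abs_square_less_1)
  moreover have "1 \<le> exp r" using assms(2) by simp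
  ultimately show ?thesis by linarith
qed

lemma radial_equation_strict_mono:
  assumes "\<bar>a\<bar> < 1" "0 \<le> r" "r < (s::real)"
  shows "r * (exp r - a\<^sup>2) < s * (exp s - a\<^sup>2)"
proof -
  have "r * (exp r - a\<^sup>2) \<le> r * (exp s - a\<^sup>2)"
    using assms by (intro mult_left_mono) auto
  also have "\<dots> < s * (exp s - a\<^sup>2)"
    using assms exp_minus_square_pos[of a s] by (intro mult_strict_right_mono) auto
  finally show ?thesis .
qed

text \<open>Monotonicity turns order statements about the implicit solution into explicit
  inequalities, continuous in \<open>a\<close> and \<open>w\<close>. Continuity and all bounds on
  \<open>rsol\<close> are read off from them.\<close>

lemma rsol_less_iff:
  assumes "\<bar>a\<bar> < 1" "0 \<le> w" "0 \<le> s"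
  shows "rsol a w < s \<longleftrightarrow> w < s * (exp s - a\<^sup>2)"
    and "s < rsol a w \<longleftrightarrow> s * (exp s - a\<^sup>2) < w"
  using rsol_eq[OF assms(1,2)] assms radial_equation_strict_mono[of a s "rsol a w"]
    radial_equation_strict_mono[of a "rsol a w" s]
  by (cases "rsol a w" s rule: linorder_cases; force)+

lemma rsol_le:
  assumes "\<bar>a\<bar> < 1" "0 \<le> w" "0 \<le> s" "w \<le> s * (exp s - a\<^sup>2)"
  shows "rsol a w \<le> s"
  using rsol_less_iff(2)[OF assms(1-3)] assms(4) by linarith

lemma rsol_zero: "\<bar>a\<bar> < 1 \<Longrightarrow> rsol a 0 = 0"
  using rsol_le[of a 0 0] rsol_eq(1)[of a 0] by simp

text \<open>Continuity up to the boundary \<open>w0 = 0\<close>: by \<open>rsol_less_iff\<close> the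
  conditions c < r and r < c are strict inequalities between continuous expressions, hence stable
  under small changes that keep \<open>w\<close> nonnegative.\<close>

lemma tendsto_rsol:
  assumes a: "(a \<longlongrightarrow> a0) F" and w: "(w \<longlongrightarrow> w0) F"
    and "\<bar>a0\<bar> < 1" "0 \<le> w0" and nn: "\<forall>\<^sub>F x in F. 0 \<le> w x"
  shows "((\<lambda>x. rsol (a x) (w x)) \<longlongrightarrow> rsol a0 w0) F"
proof -
  have ev: "\<forall>\<^sub>F x in F. \<bar>a x\<bar> < 1"
    using order_tendstoD(2)[OF tendsto_rabs[OF a] assms(3)] .
  show ?thesis
  proof (rule order_tendstoI)
    fix c assume c: "c < rsol a0 w0"
    show "\<forall>\<^sub>F x in F. c < rsol (a x) (w x)"
    proof (cases "0 \<le> c")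
      case False
      from ev nn show ?thesis
        by eventually_elim (use False rsol_eq(1) in force)
    next
      case True
      have "((\<lambda>x. w x - c * (exp c - (a x)\<^sup>2)) \<longlongrightarrow> w0 - c * (exp c - a0\<^sup>2)) F"
        by (intro tendsto_intros a w)
      moreover have "0 < w0 - c * (exp c - a0\<^sup>2)"
        using c rsol_less_iff(2)[OF assms(3,4) True] by simp
      ultimately have "\<forall>\<^sub>F x in F. 0 < w x - c * (exp c - (a x)\<^sup>2)"
        by (rule order_tendstoD(1))
      with ev nn show ?thesis
        by eventually_elim (use True rsol_less_iff(2) in force)
    qed
  next
    fix c assume c: "rsol a0 w0 < c"
    have c0: "0 \<le> c" using c rsol_eq(1)[OF assms(3,4)] by linarith
    have "((\<lambda>x. w x - c * (exp c - (a x)\<^sup>2)) \<longlongrightarrow> w0 - c * (exp c - a0\<^sup>2)) F"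
      by (intro tendsto_intros a w)
    moreover have "w0 - c * (exp c - a0\<^sup>2) < 0"
      using c rsol_less_iff(1)[OF assms(3,4) c0] by simp
    ultimately have "\<forall>\<^sub>F x in F. w x - c * (exp c - (a x)\<^sup>2) < 0"
      by (rule order_tendstoD(2))
    with ev nn show "\<forall>\<^sub>F x in F. rsol (a x) (w x) < c"
      by eventually_elim (use c0 rsol_less_iff(1) in force)
  qed
qed

lemma ssol_eq:
  assumes "\<bar>a\<bar> < 1" "0 \<le> w"
  shows "0 < ssol a w" "(ssol a w)\<^sup>2 = exp (rsol a w) - a\<^sup>2"
    "rsol a w * (ssol a w)\<^sup>2 = w"
  using exp_minus_square_pos[OF assms(1) rsol_eq(1)[OF assms]] rsol_eq[OF assms]
  by (simp_all add: ssol_def)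

lemma ssol_ge:
  assumes "\<bar>a\<bar> \<le> c" "c < 1" "0 \<le> w"
  shows "sqrt (1 - c\<^sup>2) \<le> ssol a w"
proof -
  have "a\<^sup>2 \<le> c\<^sup>2" using assms(1) by (simp add: power2_le_iff_abs_le)
  moreover have "1 \<le> exp (rsol a w)" using rsol_eq(1)[of a w] assms by simp
  ultimately show ?thesis unfolding ssol_def by (intro real_sqrt_le_mono) linarith
qed

lemma angle_arg_bound:
  assumes "\<bar>a\<bar> < 1" "0 \<le> w"
  shows "\<bar>- a * exp (- rsol a w / 2)\<bar> < 1"
proof -
  have "\<bar>a\<bar> * exp (- rsol a w / 2) \<le> \<bar>a\<bar> * 1"
    using rsol_eq(1)[OF assms] by (intro mult_left_mono) auto
  then show ?thesis using assms by (simp add: abs_mult)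
qed

lemma angle_sol_bounds:
  assumes "\<bar>a\<bar> < 1" "0 \<le> w"
  shows "0 \<le> angle_sol a w" "angle_sol a w \<le> pi"
  using angle_arg_bound[OF assms] unfolding angle_sol_def
  by (auto intro!: arccos_lbound arccos_ubound simp: abs_less_iff)

lemma tendsto_ssol:
  assumes "(a \<longlongrightarrow> a0) F" "(w \<longlongrightarrow> w0) F" "\<bar>a0\<bar> < 1" "0 \<le> w0" "\<forall>\<^sub>F x in F. 0 \<le> w x"
  shows "((\<lambda>x. ssol (a x) (w x)) \<longlongrightarrow> ssol a0 w0) F"
  unfolding ssol_def by (intro tendsto_intros tendsto_rsol assms)

lemma tendsto_angle_sol:
  assumes "(a \<longlongrightarrow> a0) F" "(w \<longlongrightarrow> w0) F" "\<bar>a0\<bar> < 1" "0 \<le> w0" "\<forall>\<^sub>F x in F. 0 \<le> w x"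
  shows "((\<lambda>x. angle_sol (a x) (w x)) \<longlongrightarrow> angle_sol a0 w0) F"
proof -
  have "isCont arccos (- a0 * exp (- rsol a0 w0 / 2))"
    using angle_arg_bound[OF assms(3,4)] by (intro isCont_arccos) auto
  then show ?thesis
    unfolding angle_sol_def
    by (rule isCont_tendsto_compose) (intro tendsto_intros tendsto_rsol assms, simp)
qed

lemma tendsto_bellman:
  assumes "(a \<longlongrightarrow> a0) F" "(w \<longlongrightarrow> w0) F" "\<bar>a0\<bar> < 1" "0 \<le> w0" "\<forall>\<^sub>F x in F. 0 \<le> w x"
  shows "((\<lambda>x. bellman (a x) (w x)) \<longlongrightarrow> bellman a0 w0) F"
  unfolding bellman_def
  by (intro tendsto_intros tendsto_rsol tendsto_ssol tendsto_angle_sol assms)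

lemma continuous_on_sol:
  assumes "continuous_on UNIV a" "continuous_on UNIV w" "\<And>x. \<bar>a x\<bar> < 1" "\<And>x. 0 \<le> w x"
  shows "continuous_on UNIV (\<lambda>x. rsol (a x) (w x))"
    "continuous_on UNIV (\<lambda>x. ssol (a x) (w x))"
    "continuous_on UNIV (\<lambda>x. angle_sol (a x) (w x))"
    "continuous_on UNIV (\<lambda>x. bellman (a x) (w x))"
  using assms unfolding continuous_on_def
  by (auto intro!: tendsto_rsol tendsto_ssol tendsto_angle_sol tendsto_bellman)

section \<open>Derivatives of the implicit solution along curves\<close>

text \<open>Implicit differentiation of r (e^r - a^2) = w; the denominator is the derivative of the
  left-hand side in r. It is done by hand along a curve because \<open>w\<close> may touch 0, where
  the nonnegative solution ceases to exist on one side.\<close>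

lemma DERIV_rsol:
  assumes a: "(a has_real_derivative a') (at t)" and w: "(w has_real_derivative w') (at t)"
    and bnd: "\<And>s. \<bar>a s\<bar> < 1" "\<And>s. 0 \<le> w s"
  shows "((\<lambda>s. rsol (a s) (w s)) has_real_derivative
     (w' + 2 * rsol (a t) (w t) * a t * a') /
     (exp (rsol (a t) (w t)) - (a t)\<^sup>2 + rsol (a t) (w t) * exp (rsol (a t) (w t)))) (at t)"
proof -
  define r where "r s = rsol (a s) (w s)" for s
  define h where "h u = u * exp u" for u :: real
  have req: "0 \<le> r s" "h (r s) - r s * (a s)\<^sup>2 = w s" for s
    using rsol_eq[OF bnd, of s s] by (simp_all add: r_def h_def algebra_simps)
  have "(h has_real_derivative exp (r t) + r t * exp (r t)) (at (r t))"
    unfolding h_def by (auto intro!: derivative_eq_intros)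
  \<comment> \<open>The Caratheodory slope of \<open>h\<close> turns the difference of the equation
    at \<open>s\<close> and \<open>t\<close> into an exact linear equation for r s - r t, with
    coefficient \<open>q s\<close>. As \<open>q\<close> tends to a positive limit, it can be divided
    out near \<open>t\<close>.\<close>
  then obtain g where g: "\<And>z. h z - h (r t) = g z * (z - r t)" "isCont g (r t)"
      "g (r t) = exp (r t) + r t * exp (r t)"
    unfolding CARAT_DERIV by blast
  have r_lim: "r \<midarrow>t\<rightarrow> r t"
    unfolding r_def using bnd DERIV_isCont[OF a] DERIV_isCont[OF w]
    by (intro tendsto_rsol) (auto simp: isCont_def)
  define q where "q s = g (r s) - (a s)\<^sup>2" for s
  have q_lim: "q \<midarrow>t\<rightarrow> exp (r t) - (a t)\<^sup>2 + r t * exp (r t)"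
  proof -
    have "q \<midarrow>t\<rightarrow> g (r t) - (a t)\<^sup>2"
      unfolding q_def using DERIV_isCont[OF a] 
      by (intro tendsto_intros isCont_tendsto_compose[OF g(2)] r_lim) (simp add: isCont_def)
    then show ?thesis by (simp add: g(3) algebra_simps)
  qed
  have pos: "0 < exp (r t) - (a t)\<^sup>2 + r t * exp (r t)"
    using exp_minus_square_pos[OF bnd(1)[of t] req(1)[of t]] req(1)[of t]
    by (intro add_pos_nonneg) auto
  have qr: "q s * (r s - r t) = (w s - w t) + r t * ((a s)\<^sup>2 - (a t)\<^sup>2)" for s
    using req(2)[of s] req(2)[of t] g(1)[of "r s"] unfolding q_def by (simp add: algebra_simps)
  have "((\<lambda>s. ((w s - w t) / (s - t) + r t * (((a s)\<^sup>2 - (a t)\<^sup>2) / (s - t))) / q s)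
      \<longlongrightarrow> (w' + r t * (2 * a t * a')) / (exp (r t) - (a t)\<^sup>2 + r t * exp (r t))) (at t)"
  proof -
    have "((\<lambda>s. (a s)\<^sup>2) has_real_derivative 2 * a t * a') (at t)"
      by (auto intro!: derivative_eq_intros a)
    then show ?thesis
      using w pos unfolding has_field_derivative_iff
      by (intro tendsto_intros q_lim) auto
  qed
  moreover have "\<forall>\<^sub>F s in at t. ((w s - w t) / (s - t) + r t * (((a s)\<^sup>2 - (a t)\<^sup>2) / (s - t))) / q s
      = (r s - r t) / (s - t)"
    using order_tendstoD(1)[OF q_lim pos]
  proof eventually_elim
    case (elim s)
    have "((w s - w t) / (s - t) + r t * (((a s)\<^sup>2 - (a t)\<^sup>2) / (s - t))) / q s
       = (((w s - w t) + r t * ((a s)\<^sup>2 - (a t)\<^sup>2)) / q s) / (s - t)"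
      by (simp add: add_divide_distrib mult.commute)
    also have "((w s - w t) + r t * ((a s)\<^sup>2 - (a t)\<^sup>2)) / q s = r s - r t"
      using elim unfolding qr[symmetric] by simp
    finally show ?case .
  qed
  ultimately have "((\<lambda>s. (r s - r t) / (s - t)) \<longlongrightarrow>
     (w' + r t * (2 * a t * a')) / (exp (r t) - (a t)\<^sup>2 + r t * exp (r t))) (at t)"
    by (rule Lim_transform_eventually)
  then show ?thesis
    unfolding has_field_derivative_iff r_def by (simp add: algebra_simps)
qed

lemma DERIV_ssol:
  assumes a: "(a has_real_derivative a') (at t)"
    and r: "((\<lambda>s. rsol (a s) (w s)) has_real_derivative r') (at t)"
    and bnd: "\<bar>a t\<bar> < 1" "0 \<le> w t"
  shows "((\<lambda>s. ssol (a s) (w s)) has_real_derivative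
     (exp (rsol (a t) (w t)) * r' - 2 * a t * a') / (2 * ssol (a t) (w t))) (at t)"
proof -
  have pos: "0 < exp (rsol (a t) (w t)) - (a t)\<^sup>2"
    using exp_minus_square_pos[OF bnd(1) rsol_eq(1)[OF bnd]] .
  show ?thesis
    unfolding ssol_def using pos
    by (auto intro!: derivative_eq_intros a r simp: field_simps)
qed

lemma DERIV_angle_sol:
  assumes a: "(a has_real_derivative a') (at t)"
    and r: "((\<lambda>s. rsol (a s) (w s)) has_real_derivative r') (at t)"
    and bnd: "\<bar>a t\<bar> < 1" "0 \<le> w t"
  shows "((\<lambda>s. angle_sol (a s) (w s)) has_real_derivative
     (a' - a t * r' / 2) / ssol (a t) (w t)) (at t)"
proof -
  let ?r = "rsol (a t) (w t)" and ?S = "ssol (a t) (w t)"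
  let ?u = "- a t * exp (- ?r / 2)"
  have u: "- 1 < ?u" "?u < 1"
    using angle_arg_bound[OF bnd] by (auto simp: abs_less_iff)
  have e2: "(exp (- ?r / 2))\<^sup>2 = exp (- ?r)"
    by (simp flip: exp_double)
  \<comment> \<open>The exponential here cancels the one produced by the chain rule, which leaves
    only \<open>S\<close> in the denominator.\<close>
  have "sqrt (1 - ?u\<^sup>2) = exp (- ?r / 2) * ?S"
  proof (rule real_sqrt_unique)
    have "(exp (- ?r / 2) * ?S)\<^sup>2 = exp (- ?r) * (exp ?r - (a t)\<^sup>2)"
      unfolding power_mult_distrib ssol_eq(2)[OF bnd] e2 ..
    also have "\<dots> = 1 - ?u\<^sup>2"
      unfolding power_mult_distrib e2 by (simp add: algebra_simps exp_minus)
    finally show "(exp (- ?r / 2) * ?S)\<^sup>2 = 1 - ?u\<^sup>2" .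
    show "0 \<le> exp (- ?r / 2) * ?S"
      using ssol_eq(1)[OF bnd] by simp
  qed
  then have arc: "DERIV arccos ?u :> inverse (- (exp (- ?r / 2) * ?S))"
    using DERIV_arccos[OF u] by simp
  have "((\<lambda>s. - a s * exp (- rsol (a s) (w s) / 2)) has_real_derivative
      - (exp (- ?r / 2) * (a' - a t * r' / 2))) (at t)"
    by (auto intro!: derivative_eq_intros a r simp: algebra_simps)
  from DERIV_chain2[OF arc this] show ?thesis
    unfolding angle_sol_def
    by (rule DERIV_cong) (use ssol_eq(1)[OF bnd] in \<open>simp add: divide_simps\<close>)
qed

text \<open>By the envelope principle the partial derivatives of \<^term>\<open>bellman a w\<close> are
  \<^term>\<open>angle_sol a w\<close> and \<^term>\<open>- 1 / (2 * ssol a w)\<close>: all terms with the derivative of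
  \<^term>\<open>rsol\<close> cancel.\<close>

lemma DERIV_bellman:
  assumes a: "(a has_real_derivative a') (at t)" and w: "(w has_real_derivative w') (at t)"
    and bnd: "\<And>s. \<bar>a s\<bar> < 1" "\<And>s. 0 \<le> w s"
  shows "((\<lambda>s. bellman (a s) (w s)) has_real_derivative
     angle_sol (a t) (w t) * a' - w' / (2 * ssol (a t) (w t))) (at t)"
proof -
  define r where "r = rsol (a t) (w t)"
  define S where "S = ssol (a t) (w t)"
  define E where "E = exp r"
  define D where "D = E - (a t)\<^sup>2 + r * E"
  define r' where "r' = (w' + 2 * r * a t * a') / D"
  have S: "S > 0" "S\<^sup>2 = E - (a t)\<^sup>2"
    using ssol_eq[OF bnd] by (simp_all add: S_def r_def E_def)
  have "r \<ge> 0" using rsol_eq(1)[OF bnd] by (simp add: r_def)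
  then have "0 < S\<^sup>2 + r * E"
    using S(1) by (intro add_pos_nonneg) (auto simp: E_def)
  then have "D > 0"
    by (simp add: D_def S(2))
  \<comment> \<open>Eliminating w' in favour of r' makes the cancellation of all r' terms a
    polynomial identity once E = S^2 + a^2 is inserted.\<close>
  then have w': "w' = r' * (S\<^sup>2 + r * E) - 2 * r * a t * a'"
    by (simp add: r'_def D_def S(2))
  have rd: "((\<lambda>s. rsol (a s) (w s)) has_real_derivative r') (at t)"
    using DERIV_rsol[OF a w bnd] by (simp add: r_def r'_def D_def E_def)
  have eq: "a' * angle_sol (a t) (w t) + (a' - a t * r' / 2) / S * a t +
       (0 - r') * S + (E * r' - 2 * a t * a') / (2 * S) * (1 - r)
    = angle_sol (a t) (w t) * a' - w' / (2 * S)"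
  proof -
    have 1: "(0 - r') * S = - (2 * r' * S\<^sup>2) / (2 * S)"
      "(a' - a t * r' / 2) / S * a t = (2 * a' * a t - (a t)\<^sup>2 * r') / (2 * S)"
      using S(1) by (simp_all add: field_simps power2_eq_square)
    have E: "E = S\<^sup>2 + (a t)\<^sup>2" using S(2) by simp
    show ?thesis
      unfolding 1 w' E using S(1) by (simp add: field_simps power2_eq_square)
  qed
  show ?thesis
    unfolding bellman_def
    by (rule DERIV_cong, (rule derivative_intros DERIV_angle_sol[OF a rd] DERIV_ssol[OF a rd] a rd bnd)+)
       (use eq in \<open>simp add: r_def S_def E_def\<close>)
qed

section \<open>Nonnegativity of the quadratic form\<close>

text \<open>Replacing X by its lower bound \<beta>^2 / (r S^2) turns the form into exactly (\<beta>
  + r a \<alpha>)^2 / (r D).\<close>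

lemma quadratic_form_nonneg:
  fixes S E r X \<beta> \<alpha> a :: real
  assumes "S > 0" "E > 0" "r > 0" and X: "\<beta>\<^sup>2 \<le> r * S\<^sup>2 * X"
  defines "D \<equiv> S\<^sup>2 + r * E"
  shows "0 \<le> a * \<alpha> * (\<beta> + r * a * \<alpha>) / D + X - \<beta> * (E * \<beta> - a * \<alpha> * S\<^sup>2) / (S\<^sup>2 * D)"
proof -
  have D: "D > 0" unfolding D_def using assms by (intro add_pos_pos) auto
  have "X \<ge> \<beta>\<^sup>2 / (r * S\<^sup>2)"
    using X assms(1,3) by (simp add: divide_simps mult.commute)
  moreover have "a * \<alpha> * (\<beta> + r * a * \<alpha>) / D + \<beta>\<^sup>2 / (r * S\<^sup>2) - \<beta> * (E * \<beta> - a * \<alpha> * S\<^sup>2) / (S\<^sup>2 * D)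
     = (\<beta> + r * a * \<alpha>)\<^sup>2 / (r * D)"
  proof -
    have "\<beta>\<^sup>2 / (r * S\<^sup>2) = \<beta>\<^sup>2 * D / (r * S\<^sup>2 * D)"
      using D by simp
    \<comment> \<open>Expanding D = S^2 + r E splits the lower bound: the second summand cancels the
      negative E \<beta>^2 term of the form, the first completes the square.\<close>
    also have "\<dots> = \<beta>\<^sup>2 / (r * D) + E * \<beta>\<^sup>2 / (S\<^sup>2 * D)"
      using D assms(1,3) by (simp add: field_simps) (simp add: D_def algebra_simps)
    finally show ?thesis
      using D assms(1,3) by (simp add: field_simps power2_eq_square)
  qed
  moreover have "0 \<le> (\<beta> + r * a * \<alpha>)\<^sup>2 / (r * D)"
    using D assms(3) by simp
  ultimately show ?thesis by linarith
qed

text \<open>\<open>V\<close> plays the gradient of P f and \<open>U i j\<close> the derivative of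
  \<open>V j\<close> in direction i; \<open>r'\<close> and \<open>S'\<close> are the resulting
  derivatives of \<open>r\<close> and \<open>S\<close>. The term w / S cancels the squares of the
  \<open>V i\<close>, after which the sum separates into one quadratic form for each direction i,
  with Cauchy-Schwarz over j supplying the bound on its X.\<close>

lemma bellman_dissipation:
  fixes V :: "'n::finite \<Rightarrow> real" and U :: "'n \<Rightarrow> 'n \<Rightarrow> real"
  assumes a: "\<bar>a\<bar> < 1" and w: "w = (\<Sum>j\<in>UNIV. (V j)\<^sup>2)"
  defines "\<beta> \<equiv> \<lambda>i. \<Sum>j\<in>UNIV. V j * U i j"
    and "r \<equiv> rsol a w" and "S \<equiv> ssol a w"
  defines "r' \<equiv> \<lambda>i. (2 * \<beta> i + 2 * r * a * V i) / (exp r - a\<^sup>2 + r * exp r)"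
  defines "S' \<equiv> \<lambda>i. (exp r * r' i - 2 * a * V i) / (2 * S)"
  shows "0 \<le> w / S - (\<Sum>i\<in>UNIV. (V i - a * r' i / 2) / S * V i
             - (\<Sum>j\<in>UNIV. (U i j * S - V j * S' i) / S\<^sup>2 * U i j))"
proof -
  have w0: "0 \<le> w" unfolding w by (intro sum_nonneg) auto
  have r: "r \<ge> 0" using rsol_eq(1)[OF a w0] by (simp add: r_def)
  have S: "S > 0" "exp r - a\<^sup>2 = S\<^sup>2" "r * S\<^sup>2 = w"
    using ssol_eq[OF a w0] by (simp_all add: S_def r_def)
  define D where "D = S\<^sup>2 + r * exp r"
  have D: "D > 0" unfolding D_def using S r by (intro add_pos_nonneg) auto
  have r': "r' i = (2 * \<beta> i + 2 * r * a * V i) / D" for i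
    by (simp add: r'_def S(2) D_def)
  have S': "S' i = (exp r * \<beta> i - a * V i * S\<^sup>2) / (S * D)" for i
  proof -
    define N where "N = exp r * \<beta> i - a * V i * S\<^sup>2"
    have "exp r * r' i - 2 * a * V i = 2 * N / D"
      unfolding r' N_def using D by (simp add: field_simps) (simp add: D_def algebra_simps)
    then have "S' i = (2 * N / D) / (2 * S)" by (simp only: S'_def)
    then show ?thesis unfolding N_def[symmetric] using D S(1) by (simp add: field_simps)
  qed
  define X where "X i = (\<Sum>j\<in>UNIV. (U i j)\<^sup>2)" for i
  have X0: "X i \<ge> 0" for i unfolding X_def by (intro sum_nonneg) auto
  have CS: "(\<beta> i)\<^sup>2 \<le> r * S\<^sup>2 * X i" for i
    unfolding S(3) w \<beta>_def X_def by (rule Cauchy_Schwarz_ineq_sum)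
  have nonneg: "0 \<le> a * V i * r' i / 2 + X i - \<beta> i * S' i / S" for i
  proof (cases "r = 0")
    \<comment> \<open>Here \<open>quadratic_form_nonneg\<close> would divide by 0. But r = 0 forces
      w = 0, so all \<open>V j\<close> and \<beta> vanish and only X is left.\<close>
    case True
    then have "w = 0" using S(3) by simp
    then have "V j = 0" for j
      unfolding w by (subst (asm) sum_nonneg_eq_0_iff) auto
    then show ?thesis by (simp add: \<beta>_def X0)
  next
    case False
    have eqs: "a * V i * (\<beta> i + r * a * V i) / D = a * V i * r' i / 2"
      "\<beta> i * (exp r * \<beta> i - a * V i * S\<^sup>2) / (S\<^sup>2 * D) = \<beta> i * S' i / S"
      unfolding r' S' using D S(1) by (simp_all add: field_simps power2_eq_square)
    show ?thesis
      using quadratic_form_nonneg[of S "exp r" r "\<beta> i" "X i" a "V i"] S(1) r False CS[of i]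
      unfolding D_def[symmetric] eqs by simp
  qed
  have "w / S - (\<Sum>i\<in>UNIV. (V i - a * r' i / 2) / S * V i
             - (\<Sum>j\<in>UNIV. (U i j * S - V j * S' i) / S\<^sup>2 * U i j))
     = (\<Sum>i\<in>UNIV. (a * V i * r' i / 2 + X i - \<beta> i * S' i / S) / S)"
  proof -
    have "(\<Sum>j\<in>UNIV. (U i j * S - V j * S' i) / S\<^sup>2 * U i j) = X i / S - \<beta> i * S' i / S\<^sup>2" for i
    proof -
      have "(U i j * S - V j * S' i) / S\<^sup>2 * U i j = (U i j)\<^sup>2 / S - V j * U i j * (S' i / S\<^sup>2)" for j
        using S(1) by (simp add: field_simps power2_eq_square)
      then show ?thesis
        by (simp add: sum_subtractf X_def \<beta>_def sum_divide_distrib sum_distrib_right)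
    qed
    moreover have "w / S = (\<Sum>i\<in>UNIV. (V i)\<^sup>2 / S)"
      by (simp add: w sum_divide_distrib)
    ultimately show ?thesis
      using S(1) by (simp add: sum_subtractf[symmetric])
        (intro sum.cong refl, simp add: field_simps power2_eq_square)
  qed
  also have "\<dots> \<ge> 0"
    using nonneg S(1) by (intro sum_nonneg) (simp add: divide_nonneg_pos)
  finally show ?thesis .
qed

section \<open>The Ornstein--Uhlenbeck semigroup\<close>

text \<open>The partial derivatives are an explicit argument, so that higher orders are expressed by
  chaining the predicate through them. Boundedness is built in for domination, and the full
  derivative for the chain rule along curves.\<close>

definition bounded_C1 :: "(real ^ 'n \<Rightarrow> real) \<Rightarrow> ('n \<Rightarrow> real ^ 'n \<Rightarrow> real) \<Rightarrow> bool" where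
  "bounded_C1 \<phi> \<phi>' \<longleftrightarrow>
     (\<forall>x. (\<phi> has_derivative (\<lambda>h. \<Sum>i\<in>UNIV. h $ i * \<phi>' i x)) (at x)) \<and>
     (\<exists>C. \<forall>x. \<bar>\<phi> x\<bar> \<le> C) \<and> (\<exists>C. \<forall>i x. \<bar>\<phi>' i x\<bar> \<le> C) \<and>
     (\<forall>i. continuous_on UNIV (\<phi>' i))"

lemma bounded_C1D:
  assumes "bounded_C1 \<phi> \<phi>'"
  shows "continuous_on UNIV \<phi>" "continuous_on UNIV (\<phi>' i)"
    "(\<phi> has_derivative (\<lambda>h. \<Sum>i\<in>UNIV. h $ i * \<phi>' i x)) (at x)"
proof -
  show "(\<phi> has_derivative (\<lambda>h. \<Sum>i\<in>UNIV. h $ i * \<phi>' i x)) (at x)" for x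
    using assms by (auto simp: bounded_C1_def)
  then show "continuous_on UNIV \<phi>"
    by (auto intro!: continuous_at_imp_continuous_on dest: has_derivative_continuous)
  show "continuous_on UNIV (\<phi>' i)"
    using assms by (auto simp: bounded_C1_def)
qed

lemma bounded_C1_curve:
  assumes "bounded_C1 \<phi> \<phi>'" and g: "(g has_vector_derivative v) (at t)"
  shows "((\<lambda>t. \<phi> (g t)) has_real_derivative (\<Sum>i\<in>UNIV. v $ i * \<phi>' i (g t))) (at t)"
proof -
  have "((\<lambda>t. \<phi> (g t)) has_derivative (\<lambda>h. \<Sum>i\<in>UNIV. (h *\<^sub>R v) $ i * \<phi>' i (g t))) (at t)"
    using has_derivative_compose[OF g[unfolded has_vector_derivative_def] bounded_C1D(3)[OF assms(1)]] .
  moreover have "(\<lambda>h. \<Sum>i\<in>UNIV. (h *\<^sub>R v) $ i * \<phi>' i (g t)) = (*) (\<Sum>i\<in>UNIV. v $ i * \<phi>' i (g t))"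
    by (simp add: fun_eq_iff sum_distrib_left mult_ac)
  ultimately show ?thesis by (simp add: has_field_derivative_def)
qed

text \<open>The Ornstein--Uhlenbeck semigroup, run for the time \<open>- ln (cos s)\<close> (Mehler's formula).\<close>

definition mehler :: "real \<Rightarrow> (real ^ 'n \<Rightarrow> real) \<Rightarrow> real ^ 'n \<Rightarrow> real" where
  "mehler s \<phi> x = (\<integral>z. \<phi> (cos s *\<^sub>R x + sin s *\<^sub>R z) \<partial>gaussian_measure)"

lemma mehler_0:
  fixes \<phi> :: "real ^ 'n \<Rightarrow> real"
  shows "mehler 0 \<phi> x = \<phi> x"
proof -
  interpret prob_space "gaussian_measure :: (real ^ 'n) measure" by (rule prob_space_gaussian)
  show ?thesis using prob_space by (simp add: mehler_def)
qed

lemma mehler_pi_half: "mehler (pi / 2) \<phi> x = (\<integral>z. \<phi> z \<partial>gaussian_measure)"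
  by (simp add: mehler_def)

lemma abs_mehler_le:
  fixes \<phi> :: "real ^ 'n \<Rightarrow> real"
  assumes [measurable]: "\<phi> \<in> borel_measurable borel" and bnd: "\<And>x. \<bar>\<phi> x\<bar> \<le> C"
  shows "\<bar>mehler s \<phi> x\<bar> \<le> C"
proof -
  interpret prob_space "gaussian_measure :: (real ^ 'n) measure" by (rule prob_space_gaussian)
  have int: "integrable gaussian_measure (\<lambda>z. \<phi> (cos s *\<^sub>R x + sin s *\<^sub>R z))"
    by (rule integrable_gaussian_bounded[where C=C]) (use bnd in auto)
  have "\<bar>mehler s \<phi> x\<bar> \<le> (\<integral>z. \<bar>\<phi> (cos s *\<^sub>R x + sin s *\<^sub>R z)\<bar> \<partial>gaussian_measure)"
    unfolding mehler_def by (rule integral_abs_bound)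
  also have "\<dots> \<le> (\<integral>z. C \<partial>(gaussian_measure :: (real ^ 'n) measure))"
    by (rule integral_mono) (use int bnd in auto)
  finally show ?thesis using prob_space by simp
qed

lemma continuous_on_mehler:
  fixes \<phi> :: "real ^ 'n \<Rightarrow> real"
  assumes cont: "continuous_on UNIV \<phi>" and bnd: "\<And>x. \<bar>\<phi> x\<bar> \<le> C"
  shows "continuous_on UNIV (mehler s \<phi>)"
  unfolding continuous_on_sequentially comp_def mehler_def
proof (intro allI ballI impI)
  fix X and x :: "real ^ 'n"
  assume X: "(\<forall>n. X n \<in> UNIV) \<and> X \<longlonglongrightarrow> x"
  have [measurable]: "\<phi> \<in> borel_measurable borel"
    by (rule borel_measurable_continuous_onI[OF cont])
  interpret prob_space "gaussian_measure :: (real ^ 'n) measure" by (rule prob_space_gaussian)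
  show "(\<lambda>n. \<integral>z. \<phi> (cos s *\<^sub>R X n + sin s *\<^sub>R z) \<partial>gaussian_measure)
      \<longlonglongrightarrow> (\<integral>z. \<phi> (cos s *\<^sub>R x + sin s *\<^sub>R z) \<partial>gaussian_measure)"
  proof (rule integral_dominated_convergence[where w="\<lambda>_. C"])
    have "(\<lambda>n. \<phi> (cos s *\<^sub>R X n + sin s *\<^sub>R z)) \<longlonglongrightarrow> \<phi> (cos s *\<^sub>R x + sin s *\<^sub>R z)" for z
      using X by (intro continuous_on_tendsto_compose[OF cont] tendsto_intros) auto
    then show "AE z in gaussian_measure.
        (\<lambda>n. \<phi> (cos s *\<^sub>R X n + sin s *\<^sub>R z)) \<longlonglongrightarrow> \<phi> (cos s *\<^sub>R x + sin s *\<^sub>R z)" by simp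
  qed (use bnd in auto)
qed

lemma DERIV_mehler_space:
  fixes \<phi> :: "real ^ 'n \<Rightarrow> real"
  assumes \<phi>: "bounded_C1 \<phi> \<phi>'"
  shows "((\<lambda>t. mehler s \<phi> (x + t *\<^sub>R axis i 1)) has_real_derivative cos s * mehler s (\<phi>' i) x) (at 0)"
proof -
  let ?e = "axis i 1 :: real ^ 'n"
  have [measurable]: "\<phi> \<in> borel_measurable borel"
    by (rule borel_measurable_continuous_onI[OF bounded_C1D(1)[OF \<phi>]])
  obtain C where C: "\<And>x. \<bar>\<phi> x\<bar> \<le> C" using \<phi> by (auto simp: bounded_C1_def)
  obtain C' where C': "\<And>i x. \<bar>\<phi>' i x\<bar> \<le> C'" using \<phi> by (auto simp: bounded_C1_def)
  interpret prob_space "gaussian_measure :: (real ^ 'n) measure" by (rule prob_space_gaussian)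
  have "((\<lambda>t. \<integral>z. \<phi> (cos s *\<^sub>R (x + t *\<^sub>R ?e) + sin s *\<^sub>R z) \<partial>gaussian_measure) has_real_derivative
     (\<integral>z. cos s * \<phi>' i (cos s *\<^sub>R (x + 0 *\<^sub>R ?e) + sin s *\<^sub>R z) \<partial>gaussian_measure)) (at 0)"
  proof (rule has_real_derivative_integral[where I=UNIV and C="\<lambda>_. C'"
        and F'="\<lambda>t z. cos s * \<phi>' i (cos s *\<^sub>R (x + t *\<^sub>R ?e) + sin s *\<^sub>R z)"])
    show "integrable gaussian_measure (\<lambda>z. \<phi> (cos s *\<^sub>R (x + t *\<^sub>R ?e) + sin s *\<^sub>R z))" for t
      by (rule integrable_gaussian_bounded[where C=C]) (use C in auto)
    show "((\<lambda>t. \<phi> (cos s *\<^sub>R (x + t *\<^sub>R ?e) + sin s *\<^sub>R z)) has_real_derivative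
        cos s * \<phi>' i (cos s *\<^sub>R (x + t *\<^sub>R ?e) + sin s *\<^sub>R z)) (at t)" for t z
    proof -
      have "((\<lambda>t. cos s *\<^sub>R (x + t *\<^sub>R ?e) + sin s *\<^sub>R z) has_vector_derivative cos s *\<^sub>R ?e) (at t)"
        by (auto intro!: derivative_eq_intros simp: has_vector_derivative_def fun_eq_iff)
      from bounded_C1_curve[OF \<phi> this] show ?thesis
        by (rule DERIV_cong) (simp add: axis_def if_distrib[of "(*) _"] if_distrib[of "\<lambda>u. u * _"] cong: if_cong)
    qed
    show "\<bar>cos s * \<phi>' i (cos s *\<^sub>R (x + t *\<^sub>R ?e) + sin s *\<^sub>R z)\<bar> \<le> C'" for t z
      using mult_mono[OF abs_cos_le_one[of s] C'[of i "cos s *\<^sub>R (x + t *\<^sub>R ?e) + sin s *\<^sub>R z"]]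
      by (simp add: abs_mult)
  qed auto
  then show ?thesis by (simp add: mehler_def)
qed

text \<open>The right-hand side is tan s times the Ornstein-Uhlenbeck generator applied to
  \<open>mehler s \<phi>\<close>, with the factors cos s from the spatial derivatives cancelled. The
  chain rule under the integral produces a factor \<open>z $ i\<close>, which integration by parts
  in z converts into sin s times a second derivative.\<close>

lemma DERIV_mehler_time:
  fixes \<phi> :: "real ^ 'n \<Rightarrow> real"
  assumes \<phi>: "bounded_C1 \<phi> \<phi>'" and \<phi>': "\<And>i. bounded_C1 (\<phi>' i) (\<phi>'' i)"
  shows "((\<lambda>s. mehler s \<phi> x) has_real_derivative
    (\<Sum>i\<in>UNIV. - sin s * (x $ i * mehler s (\<phi>' i) x) + cos s * sin s * mehler s (\<phi>'' i i) x)) (at s)"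
proof -
  have [measurable]: "\<phi> \<in> borel_measurable borel" "\<phi>' i \<in> borel_measurable borel"
    "\<phi>'' i i \<in> borel_measurable borel" for i
    by (rule borel_measurable_continuous_onI, rule bounded_C1D[OF \<phi>] bounded_C1D[OF \<phi>'])+
  obtain C where C: "\<And>x. \<bar>\<phi> x\<bar> \<le> C" using \<phi> by (auto simp: bounded_C1_def)
  obtain C' where C': "\<And>i x. \<bar>\<phi>' i x\<bar> \<le> C'" using \<phi> by (auto simp: bounded_C1_def)
  have "C' \<ge> 0" using C'[of undefined 0] by linarith
  interpret prob_space "gaussian_measure :: (real ^ 'n) measure" by (rule prob_space_gaussian)
  let ?p = "\<lambda>s z. cos s *\<^sub>R x + sin s *\<^sub>R z"
  let ?F' = "\<lambda>s z. \<Sum>i\<in>UNIV. (- sin s * x $ i + cos s * z $ i) * \<phi>' i (?p s z)"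
  have "((\<lambda>s. \<integral>z. \<phi> (?p s z) \<partial>gaussian_measure) has_real_derivative
     (\<integral>z. ?F' s z \<partial>gaussian_measure)) (at s)"
  proof (rule has_real_derivative_integral[where I=UNIV 
        and C="\<lambda>z. (\<Sum>i\<in>(UNIV::'n set). C' * (1 + norm x)) * (1 + norm z)" and F'="?F'"])
    show "integrable gaussian_measure (\<lambda>z. \<phi> (?p t z))" for t
      by (rule integrable_gaussian_bounded[where C=C]) (use C in auto)
    show "((\<lambda>t. \<phi> (?p t z)) has_real_derivative ?F' t z) (at t)" for t z
    proof -
      have "((\<lambda>t. ?p t z) has_vector_derivative (- sin t *\<^sub>R x + cos t *\<^sub>R z)) (at t)"
        by (auto intro!: derivative_eq_intros simp: has_vector_derivative_def fun_eq_iff algebra_simps)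
      from bounded_C1_curve[OF \<phi> this] show ?thesis by simp
    qed
    show "\<bar>?F' t z\<bar> \<le> (\<Sum>i\<in>(UNIV::'n set). C' * (1 + norm x)) * (1 + norm z)" for t z
    proof -
      have "\<bar>(- sin t * x $ i + cos t * z $ i) * \<phi>' i (?p t z)\<bar> \<le> (C' * (1 + norm x)) * (1 + norm z)" for i
      proof -
        have "\<bar>- sin t * x $ i + cos t * z $ i\<bar> \<le> \<bar>sin t\<bar> * \<bar>x $ i\<bar> + \<bar>cos t\<bar> * \<bar>z $ i\<bar>"
          using abs_triangle_ineq[of "- sin t * x $ i" "cos t * z $ i"] by (simp add: abs_mult)
        also have "\<dots> \<le> 1 * norm x + 1 * norm z"
          by (intro add_mono mult_mono component_le_norm_cart) auto
        also have "\<dots> \<le> (1 + norm x) * (1 + norm z)"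
          by (simp add: algebra_simps)
        finally show ?thesis
          using C'[of i "?p t z"] \<open>C' \<ge> 0\<close> unfolding abs_mult
          by (subst mult.commute) (auto simp: mult.assoc intro!: mult_mono)
      qed
      then show ?thesis
        unfolding sum_distrib_right by (intro order_trans[OF sum_abs] sum_mono)
    qed
    show "integrable gaussian_measure (\<lambda>z::real^'n. (\<Sum>i\<in>(UNIV::'n set). C' * (1 + norm x)) * (1 + norm z))"
      by (rule integrable_gaussian_linear_growth[where C="\<Sum>i\<in>(UNIV::'n set). C' * (1 + norm x)"])
        (use \<open>C' \<ge> 0\<close> in \<open>auto simp: abs_mult\<close>)
  qed auto
  moreover have "(\<integral>z. ?F' s z \<partial>gaussian_measure) =
    (\<Sum>i\<in>UNIV. - sin s * (x $ i * mehler s (\<phi>' i) x) + cos s * sin s * mehler s (\<phi>'' i i) x)"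
  proof -
    have int1: "integrable gaussian_measure (\<lambda>z. \<phi>' i (?p s z))" for i
      by (rule integrable_gaussian_bounded[where C=C']) (use C' in auto)
    have int2: "integrable gaussian_measure (\<lambda>z. z $ i * \<phi>' i (?p s z))" for i
    proof (rule integrable_gaussian_linear_growth[where C=C'])
      fix z :: "real ^ 'n"
      have "\<bar>z $ i\<bar> * \<bar>\<phi>' i (?p s z)\<bar> \<le> (1 + norm z) * C'"
        using C' component_le_norm_cart[of z i] by (intro mult_mono) auto
      then show "\<bar>z $ i * \<phi>' i (?p s z)\<bar> \<le> C' * (1 + norm z)"
        by (simp add: abs_mult mult.commute)
    qed auto
    have ibp: "(\<integral>z. z $ i * \<phi>' i (?p s z) \<partial>gaussian_measure) = sin s * mehler s (\<phi>'' i i) x" for i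
    proof -
      obtain C'' where C'': "\<And>j x. \<bar>\<phi>'' i j x\<bar> \<le> C''" using \<phi>'[of i] by (auto simp: bounded_C1_def)
      have "(\<integral>z. z $ i * \<phi>' i (?p s z) \<partial>gaussian_measure) = (\<integral>z. sin s * \<phi>'' i i (?p s z) \<partial>gaussian_measure)"
      proof (rule gaussian_integration_by_parts[where C=C' and C'=C''])
        show "\<bar>sin s * \<phi>'' i i (?p s z)\<bar> \<le> C''" for z
          using mult_mono[OF abs_sin_le_one[of s] C''[of i "?p s z"]] by (simp add: abs_mult)
        show "((\<lambda>t. \<phi>' i (?p s (z + t *\<^sub>R axis i 1))) has_real_derivative sin s * \<phi>'' i i (?p s z)) (at 0)" for z
        proof -
          have "((\<lambda>t. ?p s (z + t *\<^sub>R axis i 1)) has_vector_derivative sin s *\<^sub>R axis i 1) (at 0)"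
            by (auto intro!: derivative_eq_intros simp: has_vector_derivative_def fun_eq_iff)
          from bounded_C1_curve[OF \<phi>'[of i] this] show ?thesis
            by (rule DERIV_cong) (simp add: axis_def if_distrib[of "(*) _"] if_distrib[of "\<lambda>u. u * _"] cong: if_cong)
        qed
      qed (use C' in auto)
      then show ?thesis by (simp add: mehler_def)
    qed
    have "(\<integral>z. ?F' s z \<partial>gaussian_measure) =
      (\<integral>z. (\<Sum>i\<in>UNIV. - sin s * x $ i * \<phi>' i (?p s z) + cos s * (z $ i * \<phi>' i (?p s z))) \<partial>gaussian_measure)"
      by (intro Bochner_Integration.integral_cong refl sum.cong) (simp add: algebra_simps)
    also have "\<dots> = (\<Sum>i\<in>UNIV. \<integral>z. - sin s * x $ i * \<phi>' i (?p s z) + cos s * (z $ i * \<phi>' i (?p s z)) \<partial>gaussian_measure)"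
      by (intro Bochner_Integration.integral_sum Bochner_Integration.integrable_add integrable_mult_right int1 int2)
    also have "\<dots> = (\<Sum>i\<in>UNIV. - sin s * x $ i * mehler s (\<phi>' i) x + cos s * (sin s * mehler s (\<phi>'' i i) x))"
      unfolding mehler_def[of s "\<phi>' _"] ibp[symmetric]
      by (intro sum.cong refl) (simp add: int1 int2 mult.assoc)
    finally show ?thesis by (simp add: mult.assoc)
  qed
  ultimately show ?thesis by (simp add: mehler_def)
qed

section \<open>Monotonicity along the semigroup\<close>

text \<open>Hiding the constant lets boundedness of long expressions follow from introduction rules.
  Functions of \<open>s\<close> and x are treated as functions of a pair, so that the bound is
  uniform in both.\<close>

definition bounded_fun :: "('a \<Rightarrow> real) \<Rightarrow> bool" where
  "bounded_fun h \<longleftrightarrow> (\<exists>C. \<forall>x. \<bar>h x\<bar> \<le> C)"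

named_theorems bounded_fun_intros

lemma bounded_fun_const [bounded_fun_intros]: "bounded_fun (\<lambda>x. c)"
  unfolding bounded_fun_def by blast

lemma bounded_fun_minus [bounded_fun_intros]: "bounded_fun f \<Longrightarrow> bounded_fun (\<lambda>x. - f x)"
  unfolding bounded_fun_def by simp

lemma bounded_fun_add [bounded_fun_intros]:
  assumes "bounded_fun f" "bounded_fun g" shows "bounded_fun (\<lambda>x. f x + g x)"
proof -
  from assms obtain C D where "\<forall>x. \<bar>f x\<bar> \<le> C" "\<forall>x. \<bar>g x\<bar> \<le> D" unfolding bounded_fun_def by blast
  then have "\<bar>f x + g x\<bar> \<le> C + D" for x
    by (intro order_trans[OF abs_triangle_ineq] add_mono) auto
  then show ?thesis unfolding bounded_fun_def by blast
qed

lemma bounded_fun_diff [bounded_fun_intros]: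
  "bounded_fun f \<Longrightarrow> bounded_fun g \<Longrightarrow> bounded_fun (\<lambda>x. f x - g x)"
  using bounded_fun_add[of f "\<lambda>x. - g x"] bounded_fun_minus[of g] by simp

lemma bounded_fun_mult [bounded_fun_intros]:
  assumes "bounded_fun f" "bounded_fun g" shows "bounded_fun (\<lambda>x. f x * g x)"
proof -
  from assms obtain C D where "\<forall>x. \<bar>f x\<bar> \<le> C" "\<forall>x. \<bar>g x\<bar> \<le> D" unfolding bounded_fun_def by blast
  then have "\<bar>f x\<bar> * \<bar>g x\<bar> \<le> C * D" for x
    by (intro mult_mono) (auto intro: order_trans[OF abs_ge_zero])
  then show ?thesis unfolding bounded_fun_def abs_mult by blast
qed

lemma bounded_fun_power [bounded_fun_intros]: "bounded_fun f \<Longrightarrow> bounded_fun (\<lambda>x. f x ^ n)"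
  by (induction n) (auto intro: bounded_fun_intros)

lemma bounded_fun_sum [bounded_fun_intros]:
  "(\<And>i. i \<in> A \<Longrightarrow> bounded_fun (f i)) \<Longrightarrow> bounded_fun (\<lambda>x. \<Sum>i\<in>A. f i x)"
  by (induction A rule: infinite_finite_induct) (auto intro: bounded_fun_intros)

lemma bounded_fun_exp [bounded_fun_intros]:
  assumes "bounded_fun f" shows "bounded_fun (\<lambda>x. exp (f x))"
proof -
  from assms obtain C where "\<forall>x. \<bar>f x\<bar> \<le> C" unfolding bounded_fun_def by blast
  then have "\<bar>exp (f x)\<bar> \<le> exp C" for x by (simp add: abs_le_iff)
  then show ?thesis unfolding bounded_fun_def by blast
qed

lemma bounded_fun_divide:
  assumes "bounded_fun f" "c > 0" "\<And>x. c \<le> g x" shows "bounded_fun (\<lambda>x. f x / g x)"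
proof -
  from assms obtain C where C: "\<forall>x. \<bar>f x\<bar> \<le> C" unfolding bounded_fun_def by blast
  have "\<bar>f x / g x\<bar> \<le> C / c" for x
  proof -
    have "\<bar>f x\<bar> / g x \<le> C / c"
      using C assms(2) assms(3)[of x] by (intro frac_le) (auto intro: order_trans[OF abs_ge_zero])
    then show ?thesis using assms(2) assms(3)[of x] by (simp add: abs_divide)
  qed
  then show ?thesis unfolding bounded_fun_def by blast
qed

lemma bounded_fun_compose: "bounded_fun f \<Longrightarrow> bounded_fun (\<lambda>x. f (g x))"
  unfolding bounded_fun_def by blast

lemma bounded_fun_mehler:
  assumes "\<phi> \<in> borel_measurable borel" "bounded_fun \<phi>"
  shows "bounded_fun (\<lambda>p. mehler (fst p) \<phi> (snd p))"
  using assms abs_mehler_le unfolding bounded_fun_def by metis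

lemma continuous_on_mehler_bounded_fun:
  "continuous_on UNIV \<phi> \<Longrightarrow> bounded_fun \<phi> \<Longrightarrow> continuous_on UNIV (mehler s \<phi>)"
  unfolding bounded_fun_def by (blast intro: continuous_on_mehler)

lemma integrable_gaussian_bounded_fun:
  fixes h :: "real ^ 'n \<Rightarrow> real"
  assumes "continuous_on UNIV h" "bounded_fun h"
  shows "integrable gaussian_measure h" "integrable gaussian_measure (\<lambda>x. x $ i * h x)"
proof -
  obtain C where C: "\<And>x. \<bar>h x\<bar> \<le> C" using assms(2) unfolding bounded_fun_def by blast
  have [measurable]: "h \<in> borel_measurable borel"
    by (rule borel_measurable_continuous_onI[OF assms(1)])
  show "integrable gaussian_measure h"
    by (rule integrable_gaussian_bounded[where C=C]) (use C in auto)
  show "integrable gaussian_measure (\<lambda>x. x $ i * h x)"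
  proof (rule integrable_gaussian_linear_growth[where C=C])
    fix x :: "real ^ 'n"
    have "\<bar>x $ i\<bar> * \<bar>h x\<bar> \<le> (1 + norm x) * C"
      using C component_le_norm_cart[of x i] by (intro mult_mono) auto
    then show "\<bar>x $ i * h x\<bar> \<le> C * (1 + norm x)"
      by (simp add: abs_mult mult.commute)
  qed auto
qed

text \<open>Three orders of derivatives enter because the time derivative of the gradient of P f
  involves second derivatives of that gradient.\<close>

lemma bellman_gaussian_inequality:
  fixes f :: "real ^ 'n \<Rightarrow> real"
  assumes f: "bounded_C1 f f1" and f1: "\<And>j. bounded_C1 (f1 j) (f2 j)"
    and f2: "\<And>j i. bounded_C1 (f2 j i) (f3 j i)"
    and c0: "\<And>x. \<bar>f x\<bar> \<le> c0" "c0 < 1"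
  shows "(\<integral>x. bellman (f x) (\<Sum>j\<in>UNIV. (f1 j x)\<^sup>2) \<partial>gaussian_measure) \<le>
     bellman (\<integral>x. f x \<partial>gaussian_measure) 0"
proof -
  define a where "a s = mehler s f" for s
  define B where "B s j = mehler s (f1 j)" for s j
  define B2 where "B2 s j i = mehler s (f2 j i)" for s j i
  define B3 where "B3 s j i = mehler s (f3 j i i)" for s j i
  define V where "V s j x = cos s * B s j x" for s j x
  define w where "w s x = (\<Sum>j\<in>UNIV. (V s j x)\<^sup>2)" for s x
  define r where "r s x = rsol (a s x) (w s x)" for s x
  define S where "S s x = ssol (a s x) (w s x)" for s x
  define \<theta> where "\<theta> s x = angle_sol (a s x) (w s x)" for s x
  note cont = bounded_C1D(1,2)[OF f] bounded_C1D(1,2)[OF f1] bounded_C1D(1,2)[OF f2]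
  have bdd: "bounded_fun f" "bounded_fun (f1 j)" "bounded_fun (f2 j i)" "bounded_fun (f3 j i k)" for i j k
    using f f1[of j] f2[of j i] unfolding bounded_C1_def bounded_fun_def by blast+
  have conts: "continuous_on UNIV (a s)" "continuous_on UNIV (B s j)" "continuous_on UNIV (B2 s j i)"
    "continuous_on UNIV (B3 s j i)" for s i j
    unfolding a_def B_def B2_def B3_def by (intro continuous_on_mehler_bounded_fun cont bdd)+
  have cV: "continuous_on UNIV (V s j)" for s j
    unfolding V_def by (intro continuous_intros conts)
  have cw: "continuous_on UNIV (w s)" for s
    unfolding w_def by (intro continuous_intros cV)
  have a_le: "\<bar>a s x\<bar> \<le> c0" for s x
    unfolding a_def using cont(1) c0(1) by (intro abs_mehler_le borel_measurable_continuous_onI)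
  have a1: "\<bar>a s x\<bar> < 1" for s x using a_le[of s x] c0(2) by linarith
  have c00: "0 \<le> c0" using c0(1)[of 0] by linarith
  have w0: "0 \<le> w s x" for s x unfolding w_def by (intro sum_nonneg) auto
  have cont_sol: "continuous_on UNIV (r s)" "continuous_on UNIV (S s)" "continuous_on UNIV (\<theta> s)"
     "continuous_on UNIV (\<lambda>x. bellman (a s x) (w s x))" for s
    using continuous_on_sol[OF conts(1)[of s] cw[of s] a1 w0] by (simp_all add: r_def S_def \<theta>_def)
  define \<sigma> where "\<sigma> = sqrt (1 - c0\<^sup>2)"
  have c2: "c0\<^sup>2 < 1" using c00 c0(2) by (simp add: abs_square_less_1)
  have \<sigma>: "\<sigma> > 0" using c2 by (simp add: \<sigma>_def)
  have S_ge: "\<sigma> \<le> S s x" for s x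
    unfolding S_def \<sigma>_def by (rule ssol_ge[OF a_le c0(2) w0])
  have S_pos: "0 < S s x" for s x using S_ge[of s x] \<sigma> by linarith
  have r0: "0 \<le> r s x" for s x unfolding r_def by (rule rsol_eq[OF a1 w0])
  \<comment> \<open>The denominator in the derivative of r. Together with S it is the only variable
    quantity divided by, and both are bounded away from 0 uniformly.\<close>
  define D where "D s x = exp (r s x) - (a s x)\<^sup>2 + r s x * exp (r s x)" for s x
  have D_ge: "\<sigma>\<^sup>2 \<le> D s x" for s x
  proof -
    have "\<sigma>\<^sup>2 \<le> (S s x)\<^sup>2" using S_ge[of s x] \<sigma> by (intro power_mono) auto
    also have "\<dots> = exp (r s x) - (a s x)\<^sup>2"
      unfolding S_def r_def by (rule ssol_eq[OF a1 w0])
    also have "\<dots> \<le> D s x"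
      unfolding D_def using r0[of s x] by simp
    finally show ?thesis .
  qed
  have D_pos: "0 < D s x" for s x using D_ge[of s x] \<sigma> by (meson less_le_trans zero_less_power)
  let ?bf = "\<lambda>h. bounded_fun (\<lambda>p. h (fst p) (snd p))"
  have bB: "?bf a" "?bf (\<lambda>s. B s j)" "?bf (\<lambda>s. B2 s j i)" "?bf (\<lambda>s. B3 s j i)" for i j
    unfolding a_def B_def B2_def B3_def
    by (intro bounded_fun_mehler borel_measurable_continuous_onI cont bdd)+
  have bcos: "bounded_fun (\<lambda>p. cos (fst p))" "bounded_fun (\<lambda>p. sin (fst p))"
    unfolding bounded_fun_def by (auto intro!: exI[of _ 1])
  have bV: "?bf (\<lambda>s. V s j)" for j unfolding V_def by (intro bounded_fun_intros bB bcos)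
  have bw: "?bf w" unfolding w_def by (intro bounded_fun_intros bV)
  have br: "?bf r"
  proof -
    obtain C where C: "\<And>s x. \<bar>w s x\<bar> \<le> C" using bw unfolding bounded_fun_def by (metis fst_conv snd_conv)
    have "\<bar>r s x\<bar> \<le> C / \<sigma>\<^sup>2" for s x
    proof -
      have "r s x * \<sigma>\<^sup>2 \<le> r s x * (S s x)\<^sup>2" 
        using S_ge[of s x] \<sigma> r0 by (intro mult_left_mono power_mono) auto
      also have "\<dots> = w s x" unfolding r_def S_def by (rule ssol_eq[OF a1 w0])
      finally have "r s x * \<sigma>\<^sup>2 \<le> C" using C[of s x] by linarith
      then show ?thesis using r0[of s x] \<sigma> by (simp add: pos_le_divide_eq)
    qed
    then show ?thesis unfolding bounded_fun_def by blast
  qed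
  have bS: "?bf S"
  proof -
    have "bounded_fun (\<lambda>p. (S (fst p) (snd p))\<^sup>2)"
      unfolding S_def ssol_eq(2)[OF a1 w0] by (intro bounded_fun_intros br[unfolded r_def] bB)
    then obtain C where "\<And>s x. \<bar>(S s x)\<^sup>2\<bar> \<le> C" unfolding bounded_fun_def by (metis fst_conv snd_conv)
    then have "\<bar>S s x\<bar> \<le> sqrt C" for s x by (intro real_le_rsqrt) simp
    then show ?thesis unfolding bounded_fun_def by blast
  qed
  have b\<theta>: "?bf \<theta>"
    unfolding bounded_fun_def \<theta>_def using angle_sol_bounds[OF a1 w0] by (intro exI[of _ pi]) auto
  note bdivS = bounded_fun_divide[OF _ \<sigma>(1) S_ge]
  have bdivD: "bounded_fun h \<Longrightarrow> bounded_fun (\<lambda>p. h p / D (fst p) (snd p))" for h :: "real \<times> (real^'n) \<Rightarrow> real"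
    by (rule bounded_fun_divide[of _ "\<sigma>\<^sup>2"]) (use \<sigma> D_ge in auto)
  note bnds = bounded_fun_intros bB bcos bV bw br bS b\<theta> bdivS bdivD

  \<comment> \<open>By the envelope formula cos s * \<open>H s i\<close> is the derivative in
    direction i of the function x -> \<open>bellman (a s x) (w s x)\<close>. \<open>K\<close>
    collects the diffusion terms of the time derivative, and \<open>Q\<close> arises because the
    factor cos s in \<open>V\<close> is differentiated in \<open>s\<close>.\<close>
  define H where "H s i x = \<theta> s x * B s i x - cos s * (\<Sum>j\<in>UNIV. V s j x * B2 s j i x) / S s x" for s i x
  define K where "K s i x = cos s * (\<theta> s x * B2 s i i x - cos s * (\<Sum>j\<in>UNIV. V s j x * B3 s j i x) / S s x)" for s i x
  define Q where "Q s x = (\<Sum>j\<in>UNIV. V s j x * B s j x) / S s x" for s x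
  \<comment> \<open>\<open>U s i j\<close> is the derivative of \<open>V s j\<close> in direction i,
    and the primed functions are the derivatives of r, S, \<theta> and \<open>H s i\<close> in
    direction i. They are written out so that boundedness and continuity can be read off before
    differentiability is shown.\<close>
  define U where "U s i j x = (cos s)\<^sup>2 * B2 s j i x" for s i j x
  define r' where "r' s i x = (2 * (\<Sum>j\<in>UNIV. V s j x * U s i j x) + 2 * r s x * a s x * V s i x) / D s x" for s i x
  define S' where "S' s i x = (exp (r s x) * r' s i x - 2 * a s x * V s i x) / (2 * S s x)" for s i x
  define \<theta>' where "\<theta>' s i x = (V s i x - a s x * r' s i x / 2) / S s x" for s i x
  define H' where "H' s i x = (\<theta>' s i x * B s i x + \<theta> s x * (cos s * B2 s i i x)) -
      cos s * (\<Sum>j\<in>UNIV. (U s i j x * S s x - V s j x * S' s i x) / (S s x)\<^sup>2 * B2 s j i x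
          + V s j x / S s x * (cos s * B3 s j i x))" for s i x
  have bH: "?bf (\<lambda>s. H s i)" "?bf (\<lambda>s. K s i)" "?bf Q" for i
    unfolding H_def K_def Q_def by (intro bnds)+
  have br': "?bf (\<lambda>s. r' s i)" for i unfolding r'_def U_def by (intro bnds)
  have bS': "?bf (\<lambda>s. S' s i)" for i
    \<comment> \<open>The denominator 2 * S is split into successive divisions by 2 and by S, the
      shape to which the quotient rules for boundedness apply.\<close>
    unfolding S'_def divide_divide_eq_left[symmetric] by (intro bnds br' bounded_fun_divide[of _ 2]) auto
  have bH': "?bf (\<lambda>s. H' s i)" for i
    unfolding H'_def \<theta>'_def U_def power2_eq_square divide_divide_eq_left[symmetric]
    by (intro bnds br' bS' bounded_fun_divide[of _ 2]) auto
  have cH: "continuous_on UNIV (H s i)" "continuous_on UNIV (K s i)" "continuous_on UNIV (Q s)" 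
      "continuous_on UNIV (H' s i)" for s i
    unfolding H_def K_def Q_def H'_def \<theta>'_def S'_def r'_def U_def D_def
    using S_pos[of s] D_pos[of s, unfolded D_def]
    by (intro continuous_intros conts cV cont_sol; simp add: less_imp_neq[THEN not_sym])+
  have at_s: "bounded_fun (\<lambda>p. h (fst p) (snd p)) \<Longrightarrow> bounded_fun (h s)" for s and h :: "real \<Rightarrow> real^'n \<Rightarrow> real"
    using bounded_fun_compose[of "\<lambda>p. h (fst p) (snd p)" "\<lambda>x. (s, x)"] by simp

  have H_deriv: "((\<lambda>t. H s i (x + t *\<^sub>R axis i 1)) has_real_derivative H' s i x) (at 0)" for s i x
  proof -
    let ?g = "\<lambda>t. x + t *\<^sub>R axis i 1"
    have da: "((\<lambda>t. a s (?g t)) has_real_derivative V s i x) (at 0)"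
      using DERIV_mehler_space[OF f] by (simp add: a_def V_def B_def)
    have dB: "((\<lambda>t. B s j (?g t)) has_real_derivative cos s * B2 s j i x) (at 0)" for j
      using DERIV_mehler_space[OF f1] by (simp add: B_def B2_def)
    have dB2: "((\<lambda>t. B2 s j i (?g t)) has_real_derivative cos s * B3 s j i x) (at 0)" for j
      using DERIV_mehler_space[OF f2] by (simp add: B3_def B2_def)
    have dV: "((\<lambda>t. V s j (?g t)) has_real_derivative U s i j x) (at 0)" for j
      using DERIV_cmult[OF dB, of "cos s" j] unfolding V_def U_def by (simp add: power2_eq_square mult.assoc)
    have dw: "((\<lambda>t. w s (?g t)) has_real_derivative 2 * (\<Sum>j\<in>UNIV. V s j x * U s i j x)) (at 0)"
      unfolding w_def
      by (rule DERIV_cong, rule DERIV_sum, rule DERIV_power, rule dV) (simp add: sum_distrib_left mult_ac)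
    have dr: "((\<lambda>t. rsol (a s (?g t)) (w s (?g t))) has_real_derivative r' s i x) (at 0)"
      using DERIV_rsol[OF da dw a1 w0] by (simp add: r'_def D_def r_def)
    have dS: "((\<lambda>t. S s (?g t)) has_real_derivative S' s i x) (at 0)"
      using DERIV_ssol[OF da dr] a1 w0 by (simp add: S'_def S_def r_def)
    have d\<theta>: "((\<lambda>t. \<theta> s (?g t)) has_real_derivative \<theta>' s i x) (at 0)"
      using DERIV_angle_sol[OF da dr] a1 w0 by (simp add: \<theta>'_def \<theta>_def S_def)
    have dVS: "((\<lambda>t. V s j (?g t) / S s (?g t)) has_real_derivative
        (U s i j x * S s x - V s j x * S' s i x) / (S s x)\<^sup>2) (at 0)" for j
      using DERIV_divide[OF dV[of j] dS] S_pos[of s x] by (simp add: power2_eq_square)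
    have eq: "H s i y = \<theta> s y * B s i y - cos s * (\<Sum>j\<in>UNIV. (V s j y / S s y) * B2 s j i y)" for y
      by (simp add: H_def sum_divide_distrib sum_distrib_left)
    show ?thesis
      unfolding eq H'_def
      by (rule DERIV_cong, rule DERIV_diff, rule DERIV_mult[OF d\<theta> dB], rule DERIV_cmult,
          rule DERIV_sum, rule DERIV_mult[OF dVS dB2]) (simp add: algebra_simps)
  qed

  \<comment> \<open>The drift is isolated as \<open>x $ i\<close> times \<open>H s i\<close>, the
    shape required for Gaussian integration by parts.\<close>
  define G where "G s x = sin s * ((\<Sum>i\<in>UNIV. K s i x - x $ i * H s i x) + Q s x)" for s x
  have bellman_deriv: "((\<lambda>s. bellman (a s x) (w s x)) has_real_derivative G s x) (at s)" for s x
  proof -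
    define A' where "A' = (\<Sum>i\<in>UNIV. - sin s * (x $ i * B s i x) + cos s * sin s * B2 s i i x)"
    define B' where "B' j = (\<Sum>i\<in>UNIV. - sin s * (x $ i * B2 s j i x) + cos s * sin s * B3 s j i x)" for j
    define V' where "V' j = - sin s * B s j x + B' j * cos s" for j
    have dA: "((\<lambda>s. a s x) has_real_derivative A') (at s)"
      using DERIV_mehler_time[OF f f1] by (simp add: a_def A'_def B_def B2_def)
    have dB: "((\<lambda>s. B s j x) has_real_derivative B' j) (at s)" for j
      using DERIV_mehler_time[OF f1 f2] by (simp add: B_def B'_def B2_def B3_def)
    have dV: "((\<lambda>s. V s j x) has_real_derivative V' j) (at s)" for j
      unfolding V_def V'_def by (intro DERIV_mult DERIV_cos dB)
    have dw: "((\<lambda>s. w s x) has_real_derivative 2 * (\<Sum>j\<in>UNIV. V s j x * V' j)) (at s)"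
      unfolding w_def
      by (rule DERIV_cong, rule DERIV_sum, rule DERIV_power, rule dV) (simp add: sum_distrib_left mult_ac)
    have 1: "\<theta> s x * A' = sin s * (\<Sum>i\<in>UNIV. cos s * (\<theta> s x * B2 s i i x) - x $ i * (\<theta> s x * B s i x))"
      unfolding A'_def sum_distrib_left by (intro sum.cong refl) (simp add: algebra_simps)
    \<comment> \<open>The sum over the gradient index j and the sum over the direction i of the
      generator are exchanged, so that the terms group by i as in \<open>H\<close> and
      \<open>K\<close>.\<close>
    have 2: "(\<Sum>j\<in>UNIV. V s j x * V' j) = - sin s * (\<Sum>j\<in>UNIV. V s j x * B s j x) +
       sin s * (\<Sum>i\<in>UNIV. cos s * (cos s * (\<Sum>j\<in>UNIV. V s j x * B3 s j i x)) -
         x $ i * (cos s * (\<Sum>j\<in>UNIV. V s j x * B2 s j i x)))"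
    proof -
      have "(\<Sum>j\<in>UNIV. V s j x * V' j) = (\<Sum>j\<in>UNIV. - sin s * (V s j x * B s j x)) +
        (\<Sum>j\<in>UNIV. \<Sum>i\<in>UNIV. sin s * (cos s * (cos s * (V s j x * B3 s j i x)) - x $ i * (cos s * (V s j x * B2 s j i x))))"
        unfolding V'_def B'_def sum_distrib_left sum_distrib_right sum.distrib[symmetric]
        by (intro sum.cong refl) (simp add: algebra_simps sum_distrib_left sum_subtractf sum.distrib)
      also have "(\<Sum>j\<in>UNIV. \<Sum>i\<in>UNIV. sin s * (cos s * (cos s * (V s j x * B3 s j i x)) - x $ i * (cos s * (V s j x * B2 s j i x)))) =
        (\<Sum>i\<in>UNIV. \<Sum>j\<in>UNIV. sin s * (cos s * (cos s * (V s j x * B3 s j i x)) - x $ i * (cos s * (V s j x * B2 s j i x))))"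
        by (rule sum.swap)
      finally show ?thesis
        by (simp only: sum_distrib_left sum_subtractf right_diff_distrib)
    qed
    have "\<theta> s x * A' - 2 * (\<Sum>j\<in>UNIV. V s j x * V' j) / (2 * S s x) =
      \<theta> s x * A' - (\<Sum>j\<in>UNIV. V s j x * V' j) / S s x"
      by simp
    also have "\<dots> = sin s * ((\<Sum>i\<in>UNIV. cos s * (\<theta> s x * B2 s i i x) - x $ i * (\<theta> s x * B s i x)) -
        (\<Sum>i\<in>UNIV. cos s * (cos s * (\<Sum>j\<in>UNIV. V s j x * B3 s j i x)) -
         x $ i * (cos s * (\<Sum>j\<in>UNIV. V s j x * B2 s j i x))) / S s x + Q s x)"
      unfolding 1 2 Q_def by (simp add: diff_divide_distrib add_divide_distrib algebra_simps)
    also have "\<dots> = G s x"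
      unfolding G_def sum_divide_distrib[of _ _ "S s x"] sum_subtractf[symmetric] H_def K_def
      by (intro arg_cong2[where f="(*)"] arg_cong2[where f="(+)"] sum.cong refl)
        (simp add: diff_divide_distrib algebra_simps)
    finally have eq: "\<theta> s x * A' - 2 * (\<Sum>j\<in>UNIV. V s j x * V' j) / (2 * S s x) = G s x" .
    show ?thesis
      using DERIV_bellman[OF dA dw a1 w0] unfolding \<theta>_def[symmetric] S_def[symmetric] eq .
  qed

  define \<Phi> where "\<Phi> s = (\<integral>x. bellman (a s x) (w s x) \<partial>gaussian_measure)" for s
  have \<Phi>_deriv: "(\<Phi> has_real_derivative (\<integral>x. G s x \<partial>gaussian_measure)) (at s)" for s
  proof -
    have "?bf (\<lambda>s x. bellman (a s x) (w s x))"
      unfolding bellman_def r_def[symmetric] S_def[symmetric] \<theta>_def[symmetric] by (intro bnds)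
    then have int: "integrable gaussian_measure (\<lambda>x. bellman (a s x) (w s x))" for s
      by (intro integrable_gaussian_bounded_fun cont_sol(4) at_s)
    have "\<exists>C. \<forall>s x. \<bar>H s i x\<bar> \<le> C" "\<exists>C. \<forall>s x. \<bar>K s i x\<bar> \<le> C" "\<exists>C. \<forall>s x. \<bar>Q s x\<bar> \<le> C" for i
      using bH(1,2)[of i] bH(3) unfolding bounded_fun_def by simp_all
    then obtain CH CK CQ where C: "\<And>i s x. \<bar>H s i x\<bar> \<le> CH i" "\<And>i s x. \<bar>K s i x\<bar> \<le> CK i" 
       "\<And>s x. \<bar>Q s x\<bar> \<le> CQ" by metis
    have C0: "0 \<le> CH i" "0 \<le> CK i" "0 \<le> CQ" for i
      using C(1)[of 0 i 0] C(2)[of 0 i 0] C(3)[of 0 0] by linarith+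
    define c where "c = (\<Sum>i\<in>UNIV. CH i + CK i) + CQ"
    \<comment> \<open>The factor \<open>x $ i\<close> is the only unbounded one, so linear growth
      uniform in \<open>s\<close> is enough to differentiate under the integral.\<close>
    have G_le: "\<bar>G s x\<bar> \<le> c * (1 + norm x)" for s x
    proof -
      have "\<bar>K s i x - x $ i * H s i x\<bar> \<le> (CH i + CK i) * (1 + norm x)" for i
      proof -
        have "\<bar>K s i x - x $ i * H s i x\<bar> \<le> \<bar>K s i x\<bar> + \<bar>x $ i\<bar> * \<bar>H s i x\<bar>"
          unfolding abs_mult[symmetric] by (rule abs_triangle_ineq4)
        also have "\<dots> \<le> CK i + norm x * CH i"
          using C component_le_norm_cart[of x i] by (intro add_mono mult_mono) auto
        also have "\<dots> \<le> (CH i + CK i) * (1 + norm x)"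
          using C0(1,2)[of i] by (simp add: algebra_simps)
        finally show ?thesis .
      qed
      then have "\<bar>\<Sum>i\<in>UNIV. K s i x - x $ i * H s i x\<bar> \<le> (\<Sum>i\<in>UNIV. CH i + CK i) * (1 + norm x)"
        unfolding sum_distrib_right by (intro order_trans[OF sum_abs] sum_mono)
      moreover have "\<bar>Q s x\<bar> \<le> CQ * (1 + norm x)"
        using C(3)[of s x] C0(3) by (simp add: algebra_simps add_increasing2)
      ultimately have le: "\<bar>(\<Sum>i\<in>UNIV. K s i x - x $ i * H s i x) + Q s x\<bar> \<le> c * (1 + norm x)"
        unfolding c_def distrib_right[of _ CQ] by (intro order_trans[OF abs_triangle_ineq] add_mono)
      have "\<bar>G s x\<bar> \<le> 1 * (c * (1 + norm x))"
        unfolding G_def abs_mult by (intro mult_mono le) auto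
      then show ?thesis by simp
    qed
    have "0 \<le> c"
      unfolding c_def using C0 by (intro add_nonneg_nonneg sum_nonneg) auto
    then have "integrable gaussian_measure (\<lambda>x::real^'n. c * (1 + norm x))"
      by (intro integrable_gaussian_linear_growth[where C=c]) (auto simp: abs_mult)
    then show ?thesis
      unfolding \<Phi>_def using int bellman_deriv G_le
      by (intro has_real_derivative_integral[where I=UNIV and F'=G and C="\<lambda>x. c * (1 + norm x)"]) auto
  qed
  have G_nonneg: "0 \<le> (\<integral>x. G s x \<partial>gaussian_measure)" if s: "0 < s" "s < pi / 2" for s
  proof -
    have trig: "0 < sin s" "0 < cos s"
      using s by (auto intro!: sin_gt_zero cos_gt_zero)
    note int = integrable_gaussian_bounded_fun[OF cH(1) at_s[OF bH(1)]]
      integrable_gaussian_bounded_fun(1)[OF cH(2) at_s[OF bH(2)]]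
      integrable_gaussian_bounded_fun(1)[OF cH(3) at_s[OF bH(3)]]
      integrable_gaussian_bounded_fun(1)[OF cH(4) at_s[OF bH']]
    have ibp: "(\<integral>x. x $ i * H s i x \<partial>gaussian_measure) = (\<integral>x. H' s i x \<partial>gaussian_measure)" for i
    proof -
      have "bounded_fun (H s i)" "bounded_fun (H' s i)"
        by (rule at_s[OF bH(1)], rule at_s[OF bH'])
      then obtain C C' where "\<And>x. \<bar>H s i x\<bar> \<le> C" "\<And>x. \<bar>H' s i x\<bar> \<le> C'"
        unfolding bounded_fun_def by blast
      then show ?thesis
        by (intro gaussian_integration_by_parts[OF borel_measurable_continuous_onI[OF cH(1)] _ _ H_deriv])
    qed
    have "(\<integral>x. G s x \<partial>gaussian_measure) = sin s * ((\<Sum>i\<in>UNIV. (\<integral>x. K s i x \<partial>gaussian_measure) -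
        (\<integral>x. x $ i * H s i x \<partial>gaussian_measure)) + (\<integral>x. Q s x \<partial>gaussian_measure))"
      unfolding G_def by (simp add: int Bochner_Integration.integral_sum)
    also have "\<dots> = sin s * (\<integral>x. (\<Sum>i\<in>UNIV. K s i x - H' s i x) + Q s x \<partial>gaussian_measure)"
      unfolding ibp by (simp add: int Bochner_Integration.integral_sum)
    also have "\<dots> \<ge> 0"
    proof (intro mult_nonneg_nonneg Bochner_Integration.integral_nonneg)
      fix x
      \<comment> \<open>In \<open>K - H'\<close> the third derivatives \<open>B3\<close> and the
        terms with \<theta> cancel. Multiplying by cos s turns the remaining \<open>B\<close> and
        \<open>B2\<close> into \<open>V\<close> and \<open>U\<close>, the quantities of
        \<open>bellman_dissipation\<close>; the sign can be read off because cos s > 0 on the open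
        interval.\<close>
      have "cos s * ((\<Sum>i\<in>UNIV. K s i x - H' s i x) + Q s x) =
        w s x / S s x - (\<Sum>i\<in>UNIV. \<theta>' s i x * V s i x
             - (\<Sum>j\<in>UNIV. (U s i j x * S s x - V s j x * S' s i x) / (S s x)\<^sup>2 * U s i j x))"
      proof -
        have "cos s * Q s x = w s x / S s x"
          by (simp add: Q_def w_def V_def power2_eq_square sum_distrib_left mult_ac)
        moreover have "cos s * (K s i x - H' s i x) = - (\<theta>' s i x * V s i x
             - (\<Sum>j\<in>UNIV. (U s i j x * S s x - V s j x * S' s i x) / (S s x)\<^sup>2 * U s i j x))" for i
        proof -
          define Y where "Y j = (U s i j x * S s x - V s j x * S' s i x) / (S s x)\<^sup>2" for j
          have 1: "(\<Sum>j\<in>UNIV. Y j * U s i j x) = cos s * (cos s * (\<Sum>j\<in>UNIV. Y j * B2 s j i x))"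
            by (simp add: U_def sum_distrib_left power2_eq_square mult_ac)
          have 2: "(\<Sum>j\<in>UNIV. Y j * B2 s j i x + V s j x / S s x * (cos s * B3 s j i x)) =
              (\<Sum>j\<in>UNIV. Y j * B2 s j i x) + cos s * (\<Sum>j\<in>UNIV. V s j x * B3 s j i x) / S s x"
            by (simp add: sum.distrib sum_distrib_left sum_divide_distrib mult_ac)
          show ?thesis
            unfolding K_def H'_def Y_def[symmetric] 1 2 by (simp add: V_def algebra_simps)
        qed
        ultimately show ?thesis
          by (simp only: distrib_left sum_distrib_left sum_negf)
      qed
      also have "\<dots> \<ge> 0"
        using bellman_dissipation[OF a1[of s x] w_def[of s x], of "\<lambda>i j. U s i j x"]
        unfolding \<theta>'_def S'_def r'_def D_def r_def S_def .
      finally show "0 \<le> (\<Sum>i\<in>UNIV. K s i x - H' s i x) + Q s x"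
        using trig by (simp add: zero_le_mult_iff)
    qed (use trig in auto)
    finally show ?thesis .
  qed
  have "\<Phi> 0 \<le> \<Phi> (pi / 2)"
  proof (rule DERIV_nonneg_imp_increasing_open[where f=\<Phi>])
    show "\<exists>y. (\<Phi> has_real_derivative y) (at s) \<and> 0 \<le> y" if "0 < s" "s < pi / 2" for s
      using \<Phi>_deriv[of s] G_nonneg[OF that] by blast
    show "continuous_on {0..pi / 2} \<Phi>"
      using \<Phi>_deriv by (intro continuous_at_imp_continuous_on) (blast intro: DERIV_isCont)
  qed simp
  moreover have "\<Phi> 0 = (\<integral>x. bellman (f x) (\<Sum>j\<in>UNIV. (f1 j x)\<^sup>2) \<partial>gaussian_measure)"
    by (simp add: \<Phi>_def w_def V_def a_def B_def mehler_0)
  \<comment> \<open>As cos (pi/2) = 0, the gradient vanishes and the integrand no longer depends on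
    x.\<close>
  moreover have "\<Phi> (pi / 2) = bellman (\<integral>x. f x \<partial>gaussian_measure) 0"
  proof -
    interpret prob_space "gaussian_measure :: (real ^ 'n) measure" by (rule prob_space_gaussian)
    show ?thesis
      using prob_space by (simp add: \<Phi>_def w_def V_def a_def mehler_pi_half)
  qed
  ultimately show ?thesis by simp
qed

section \<open>Truncation\<close>

lemma times_differentiable_SucD:
  "times_differentiable (Suc k) f \<Longrightarrow> times_differentiable k f"
proof (induction k arbitrary: f)
  case 0
  then show ?case
    by (auto intro!: continuous_at_imp_continuous_on differentiable_imp_continuous_within)
next
  case (Suc k)
  from Suc.prems show ?case
    by (auto intro: Suc.IH simp del: times_differentiable.simps(2) simp: times_differentiable.simps(2)[of "Suc k"] times_differentiable.simps(2)[of k f])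
qed

lemma times_differentiable_const: "times_differentiable k (\<lambda>x. c)"
  by (induction k arbitrary: c) auto

lemma times_differentiable_bounded_linear:
  assumes "bounded_linear f" shows "times_differentiable k f"
proof (cases k)
  case 0
  then show ?thesis using assms by (simp add: linear_continuous_on)
next
  case (Suc m)
  have "(f has_derivative f) (at x)" for x
    using assms by (rule bounded_linear_imp_has_derivative)
  then show ?thesis
    using frechet_derivative_at[of f f] unfolding Suc
    by (auto simp: differentiable_def times_differentiable_const simp flip: frechet_derivative_at)
qed

lemma times_differentiable_add:
  "times_differentiable k f \<Longrightarrow> times_differentiable k g \<Longrightarrow> times_differentiable k (\<lambda>x. f x + g x)"
proof (induction k arbitrary: f g)
  case 0
  then show ?case by (auto intro: continuous_intros)
next
  case (Suc k)
  have "frechet_derivative (\<lambda>x. f x + g x) (at x) = (\<lambda>v. frechet_derivative f (at x) v + frechet_derivative g (at x) v)" for x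
    using Suc.prems by (intro frechet_derivative_at[symmetric] derivative_intros)
      (auto simp: frechet_derivative_works[symmetric])
  then show ?case using Suc by auto
qed

lemma times_differentiable_mult:
  "times_differentiable k f \<Longrightarrow> times_differentiable k g \<Longrightarrow> times_differentiable k (\<lambda>x. f x * g x)"
proof (induction k arbitrary: f g)
  case 0
  then show ?case by (auto intro: continuous_intros)
next
  case (Suc k)
  have "frechet_derivative (\<lambda>x. f x * g x) (at x) =
      (\<lambda>v. f x * frechet_derivative g (at x) v + frechet_derivative f (at x) v * g x)" for x
    using Suc.prems by (intro frechet_derivative_at[symmetric] has_derivative_mult)
      (auto simp: frechet_derivative_works[symmetric])
  moreover have "times_differentiable k f" "times_differentiable k g"
    using Suc.prems by (blast intro: times_differentiable_SucD)+
  ultimately show ?case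
    using Suc by (auto intro!: times_differentiable_add)
qed

text \<open>The exponent is at least 2, so at the kink t = 0 the difference quotient is bounded by a
  positive power of max 0 h and tends to 0. Away from 0 the function agrees locally with a power or
  with 0.\<close>

lemma DERIV_max_0_power:
  "((\<lambda>t. max 0 t ^ Suc (Suc n)) has_real_derivative real (n + 2) * max 0 t ^ Suc n) (at (t::real))"
proof -
  consider "t > 0" | "t < 0" | "t = 0" by linarith
  then show ?thesis
  proof cases
    case 1
    have "((\<lambda>t. t ^ Suc (Suc n)) has_real_derivative real (n + 2) * t ^ Suc n) (at t)"
      by (rule derivative_eq_intros refl | simp)+
    moreover have "\<forall>\<^sub>F u in nhds t. u ^ Suc (Suc n) = max 0 u ^ Suc (Suc n)"
      using order_tendstoD(1)[OF tendsto_ident_at[of t UNIV] 1] 1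
      by (auto simp: eventually_at_filter elim!: eventually_mono)
    ultimately show ?thesis
      using 1 by (subst (asm) DERIV_cong_ev[OF refl _ refl]) auto
  next
    case 2
    have "((\<lambda>t. 0) has_real_derivative 0) (at t)" by simp
    moreover have "\<forall>\<^sub>F u in nhds t. 0 = max 0 u ^ Suc (Suc n)"
      using order_tendstoD(2)[OF tendsto_ident_at[of t UNIV] 2] 2
      by (auto simp: eventually_at_filter elim!: eventually_mono)
    ultimately show ?thesis
      using 2 by (subst (asm) DERIV_cong_ev[OF refl _ refl]) auto
  next
    case 3
    have "((\<lambda>h::real. max 0 h ^ Suc (Suc n) / h) \<longlongrightarrow> 0) (at 0)"
    proof (rule Lim_null_comparison[where g="\<lambda>h. max 0 h ^ Suc n"])
      show "\<forall>\<^sub>F h::real in at 0. norm (max 0 h ^ Suc (Suc n) / h) \<le> max 0 h ^ Suc n"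
        by (intro always_eventually) (auto simp: max_def)
      have "((\<lambda>h::real. max 0 h ^ Suc n) \<longlongrightarrow> max 0 0 ^ Suc n) (at 0)"
        by (intro tendsto_intros)
      then show "((\<lambda>h::real. max 0 h ^ Suc n) \<longlongrightarrow> 0) (at 0)" by simp
    qed
    then show ?thesis
      by (simp add: has_field_derivative_iff 3)
  qed
qed

text \<open>Each differentiation costs one power of the positive part and leaves a smooth factor.
  After k of them the exponent is 1, which is still continuous.\<close>

lemma times_differentiable_max_0_power:
  assumes "\<And>k. times_differentiable k q"
  shows "times_differentiable k (\<lambda>x. max 0 (q x) ^ Suc k)"
proof (induction k)
  case 0
  then show ?case using assms[of 0] by (auto intro!: continuous_intros)
next
  case (Suc k)
  have d: "((\<lambda>x. max 0 (q x) ^ Suc (Suc k)) has_derivative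
      (\<lambda>v. frechet_derivative q (at x) v * (real (k + 2) * max 0 (q x) ^ Suc k))) (at x)" for x
  proof -
    have "(q has_derivative frechet_derivative q (at x)) (at x)"
      using assms[of 1] by (auto simp: frechet_derivative_works[symmetric])
    from DERIV_compose_FDERIV[OF DERIV_max_0_power this] show ?thesis .
  qed
  have "times_differentiable k (\<lambda>x. frechet_derivative q (at x) v * (real (k + 2) * max 0 (q x) ^ Suc k))" for v
    using assms[of "Suc k"] Suc by (intro times_differentiable_mult times_differentiable_const) auto
  then show ?case
    using d by (auto simp: differentiable_def frechet_derivative_at[OF d, symmetric] simp del: power_Suc)
qed

section \<open>The cutoff and its gradient\<close>

definition cutoff :: "real \<Rightarrow> 'a::euclidean_space \<Rightarrow> real" where
  "cutoff R x = max 0 (1 - (norm x)\<^sup>2 / R\<^sup>2) ^ 4"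

lemma times_differentiable_cutoff: "times_differentiable 3 (cutoff R)"
proof -
  have "times_differentiable k (\<lambda>x::'a. 1 + (- 1 / R\<^sup>2) * (\<Sum>b\<in>Basis. (x \<bullet> b) * (x \<bullet> b)))" for k
  proof -
    have "times_differentiable k (\<lambda>x::'a. (x \<bullet> b) * (x \<bullet> b))" for b
      by (intro times_differentiable_mult times_differentiable_bounded_linear bounded_linear_inner_left)
    then have "times_differentiable k (\<lambda>x::'a. \<Sum>b\<in>A. (x \<bullet> b) * (x \<bullet> b))" for A
      by (induction A rule: infinite_finite_induct)
        (simp_all add: times_differentiable_const times_differentiable_add)
    then show ?thesis
      by (intro times_differentiable_add times_differentiable_mult times_differentiable_const)
  qed
  from times_differentiable_max_0_power[OF this, of 3]
  have "times_differentiable 3 (\<lambda>x::'a. max 0 (1 + (- 1 / R\<^sup>2) * (\<Sum>b\<in>Basis. (x \<bullet> b) * (x \<bullet> b))) ^ Suc 3)" .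
  also have "(\<lambda>x::'a. max 0 (1 + (- 1 / R\<^sup>2) * (\<Sum>b\<in>Basis. (x \<bullet> b) * (x \<bullet> b))) ^ Suc 3) = cutoff R"
    unfolding euclidean_inner[symmetric] by (auto simp: cutoff_def power2_norm_eq_inner)
  finally show ?thesis .
qed

lemma cutoff_bounds: "0 \<le> cutoff R x" "cutoff R x \<le> 1"
  unfolding cutoff_def by (auto intro!: power_le_one)

lemma cutoff_eq_0: "0 < R \<Longrightarrow> x \<notin> cball 0 R \<Longrightarrow> cutoff R x = 0"
  by (simp add: cutoff_def divide_simps)

lemma GDERIV_cutoff:
  "GDERIV (cutoff R) x :> (- 8 / R\<^sup>2 * max 0 (1 - (norm x)\<^sup>2 / R\<^sup>2) ^ 3) *\<^sub>R x"
proof -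
  have "((\<lambda>x. 1 - (x \<bullet> x) / R\<^sup>2) has_derivative (\<lambda>h. - 2 / R\<^sup>2 * (h \<bullet> x))) (at x)"
    unfolding divide_inverse by (auto intro!: derivative_eq_intros simp: inner_commute)
  from DERIV_compose_FDERIV[OF DERIV_max_0_power[of 2] this]
  show ?thesis
    unfolding gderiv_def cutoff_def power2_norm_eq_inner by (simp add: mult_ac numeral_eq_Suc)
qed

text \<open>On the ball the norm is at most (8 / R^2) * R, which is why radii start at 8; outside it
  the gradient is zero. The bound 1 is what allows the truncation to raise the norm of the gradient
  of f by at most 1.\<close>

lemma norm_gradient_cutoff:
  assumes "8 \<le> R"
  shows "norm ((- 8 / R\<^sup>2 * max 0 (1 - (norm x)\<^sup>2 / R\<^sup>2) ^ 3) *\<^sub>R x) \<le> 1"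
proof (cases "norm x \<le> R")
  case True
  have "8 / R\<^sup>2 * max 0 (1 - (norm x)\<^sup>2 / R\<^sup>2) ^ 3 * norm x \<le> 8 / R\<^sup>2 * 1 * R"
    using assms True by (intro mult_mono power_le_one) auto
  also have "\<dots> \<le> 1" using assms by (simp add: power2_eq_square)
  finally show ?thesis by (simp add: abs_mult)
next
  case False
  then have "R\<^sup>2 \<le> (norm x)\<^sup>2" using assms by (intro power_mono) auto
  then have "max 0 (1 - (norm x)\<^sup>2 / R\<^sup>2) = 0" using assms by (simp add: divide_simps)
  then show ?thesis by simp
qed

section \<open>Gradients, partial derivatives and compact support\<close>

lemma gradient_eqI:
  assumes "GDERIV f x :> D" shows "gradient f x = D"
  unfolding gradient_def
proof (rule the_equality)
  show "E = D" if "GDERIV f x :> E" for E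
    using has_derivative_unique[OF that[unfolded gderiv_def] assms[unfolded gderiv_def]]
    by (metis vector_eq_ldot)
qed fact

lemma frechet_derivative_axis_eq_gradient:
  fixes f :: "real ^ 'n \<Rightarrow> real"
  assumes "f differentiable (at x)"
  shows "frechet_derivative f (at x) (axis j 1) = gradient f x $ j"
proof -
  have "frechet_derivative f (at x) = (\<lambda>h. h \<bullet> gradient f x)"
    using gderiv_gradient[OF assms] unfolding gderiv_def by (metis frechet_derivative_at)
  then show ?thesis by (simp add: inner_axis')
qed

lemma power2_norm_gradient:
  fixes f :: "real ^ 'n \<Rightarrow> real"
  assumes "f differentiable (at x)"
  shows "(norm (gradient f x))\<^sup>2 = (\<Sum>j\<in>UNIV. (frechet_derivative f (at x) (axis j 1))\<^sup>2)"
  unfolding frechet_derivative_axis_eq_gradient[OF assms] power2_norm_eq_inner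
  by (simp add: inner_vec_def power2_eq_square)

text \<open>A continuous function vanishing off a ball is bounded. The complement of the closed ball
  is open, so the partial derivatives vanish there too; they satisfy the hypotheses at the next
  lower order, and the lemma can be iterated.\<close>

lemma bounded_C1_compact_support:
  fixes g :: "real ^ 'n \<Rightarrow> real"
  assumes g: "times_differentiable (Suc k) g" and supp: "\<And>x. x \<notin> cball 0 R \<Longrightarrow> g x = 0"
  defines "g' \<equiv> \<lambda>j x. frechet_derivative g (at x) (axis j 1)"
  shows "bounded_C1 g g'" "times_differentiable k (g' j)" "\<And>x. x \<notin> cball 0 R \<Longrightarrow> g' j x = 0"
proof -
  have cont_bdd: "\<exists>C. \<forall>x. \<bar>h x\<bar> \<le> C" if "continuous_on UNIV h" "\<And>x. x \<notin> cball 0 R \<Longrightarrow> h x = 0"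
    for h :: "real ^ 'n \<Rightarrow> real"
  proof -
    have "bounded (h ` cball 0 R)"
      using that(1) by (intro compact_imp_bounded compact_continuous_image) (auto intro: continuous_on_subset)
    then obtain C where C: "\<And>x. x \<in> cball 0 R \<Longrightarrow> \<bar>h x\<bar> \<le> C" unfolding bounded_iff by (metis imageI real_norm_def)
    have "\<bar>h x\<bar> \<le> max C 0" for x
      using C[of x] that(2)[of x] by (cases "x \<in> cball 0 R") auto
    then show ?thesis by blast
  qed
  have td0: "continuous_on UNIV h" if "times_differentiable m h" for m and h :: "real ^ 'n \<Rightarrow> real"
    using that by (induction m) (auto dest: times_differentiable_SucD simp del: times_differentiable.simps(2))
  show td: "times_differentiable k (g' j)" for j using g by (simp add: g'_def)
  have diff: "g differentiable (at x)" for x using g by simp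
  show supp': "g' j x = 0" if x: "x \<notin> cball 0 R" for x j
  proof -
    have "((\<lambda>x. 0) has_derivative (\<lambda>h. 0)) (at x)" by simp
    then have "(g has_derivative (\<lambda>h. 0)) (at x)"
      by (rule has_derivative_transform_within_open[OF _ open_Compl[OF closed_cball[of 0 R]]]) (use x supp in auto)
    from frechet_derivative_at[OF this, symmetric] show ?thesis by (simp add: g'_def)
  qed
  have "(g has_derivative (\<lambda>h. \<Sum>i\<in>UNIV. h $ i * g' i x)) (at x)" for x
  proof -
    have d: "(g has_derivative frechet_derivative g (at x)) (at x)"
      using diff by (simp add: frechet_derivative_works)
    then interpret linear "frechet_derivative g (at x)" by (rule has_derivative_linear)
    have "frechet_derivative g (at x) h = (\<Sum>i\<in>UNIV. h $ i * g' i x)" for h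
      by (subst basis_expansion[of h, symmetric]) (simp add: sum scale g'_def scalar_mult_eq_scaleR)
    then have "frechet_derivative g (at x) = (\<lambda>h. \<Sum>i\<in>UNIV. h $ i * g' i x)" by (rule ext)
    with d show ?thesis by simp
  qed
  moreover have "\<exists>C. \<forall>x. \<bar>g x\<bar> \<le> C" by (rule cont_bdd[OF td0[OF g] supp])
  moreover have "\<exists>C. \<forall>i x. \<bar>g' i x\<bar> \<le> C"
  proof -
    have "\<exists>C. \<forall>x. \<bar>g' i x\<bar> \<le> C" for i by (rule cont_bdd[OF td0[OF td] supp'])
    then obtain C where C: "\<And>i x. \<bar>g' i x\<bar> \<le> C i" by metis
    have "\<bar>g' i x\<bar> \<le> Max (range C)" for i x
      by (rule order_trans[OF C]) simp
    then show ?thesis by blast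
  qed
  ultimately show "bounded_C1 g g'"
    unfolding bounded_C1_def using td0[OF td] by blast
qed

section \<open>Pointwise bounds on the integrand\<close>

text \<open>Up to bounded terms M is S - r S, so its size is governed by P = r S; primes denote the
  truncated data. With P' <= 4 P + 3, S' <= 3 + P' and P <= 6 + 2 pi + 2 |M|, the chain |M'| <= pi +
  S' + P' <= pi + 9 + 8 P gives the constants 57, 17 and 16.\<close>

lemma bellman_growth:
  assumes "\<bar>a\<bar> < 1" "0 \<le> y" "\<bar>a'\<bar> \<le> \<bar>a\<bar>" "0 \<le> y'" "y' \<le> y + 1"
  shows "\<bar>bellman a' (y'\<^sup>2)\<bar> \<le> 57 + 17 * pi + 16 * \<bar>bellman a (y\<^sup>2)\<bar>"
proof -
  have a': "\<bar>a'\<bar> < 1" using assms by linarith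
  have a2: "a'\<^sup>2 \<le> a\<^sup>2" "a'\<^sup>2 \<le> 1" "a\<^sup>2 \<le> 1"
    using assms a' by (auto simp: abs_le_square_iff[symmetric] abs_square_le_1)
  define r S r' S' where "r = rsol a (y\<^sup>2)" "S = ssol a (y\<^sup>2)" "r' = rsol a' (y'\<^sup>2)" "S' = ssol a' (y'\<^sup>2)"
  note defs = this
  have r: "0 \<le> r" "0 \<le> r'" "0 < S" "0 < S'" "r * S\<^sup>2 = y\<^sup>2" "r' * S'\<^sup>2 = y'\<^sup>2"
    "S\<^sup>2 = exp r - a\<^sup>2" "S'\<^sup>2 = exp r' - a'\<^sup>2"
    using rsol_eq(1)[of a "y\<^sup>2"] rsol_eq(1)[of a' "y'\<^sup>2"] ssol_eq[of a "y\<^sup>2"] ssol_eq[of a' "y'\<^sup>2"] assms(1) a'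
    by (simp_all add: defs)
  have ang: "\<bar>a * angle_sol a (y\<^sup>2)\<bar> \<le> pi" "\<bar>a' * angle_sol a' (y'\<^sup>2)\<bar> \<le> pi"
    using angle_sol_bounds[of a "y\<^sup>2"] angle_sol_bounds[of a' "y'\<^sup>2"] assms(1) a'
      mult_mono[of "\<bar>a\<bar>" 1 "\<bar>angle_sol a (y\<^sup>2)\<bar>" pi] mult_mono[of "\<bar>a'\<bar>" 1 "\<bar>angle_sol a' (y'\<^sup>2)\<bar>" pi]
    by (simp_all add: abs_mult)
  have e1: "exp 1 \<le> (3::real)" by (rule exp_le)
  have e2: "exp 2 \<le> (9::real)" 
    using mult_mono[OF e1 e1] by (simp flip: exp_add)
  \<comment> \<open>This removes S from the comparison: it suffices to compare r' with r and y' with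
    y.\<close>
  have sq: "(r * S)\<^sup>2 = r * y\<^sup>2" "(r' * S')\<^sup>2 = r' * y'\<^sup>2"
    using r(5,6) by (simp_all add: power2_eq_square mult_ac flip: r(5,6))
  have P': "r' * S' \<le> 4 * (r * S) + 3"
  proof (cases "y \<le> 1")
    case True
    have y': "y'\<^sup>2 \<le> 2\<^sup>2" using True assms by (intro power_mono) auto
    have "r' \<le> 2"
      unfolding defs
    proof (rule rsol_le[OF a'])
      have "1 + 2 \<le> exp (2::real)" by (rule exp_ge_add_one_self)
      then show "y'\<^sup>2 \<le> 2 * (exp 2 - a'\<^sup>2)" using y' a2(2) by simp
    qed auto
    then have "(r' * S')\<^sup>2 \<le> 2 * 2\<^sup>2"
      unfolding sq using y' r(2) by (intro mult_mono) auto
    then have "(r' * S')\<^sup>2 \<le> 3\<^sup>2" by simp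
    then have "r' * S' \<le> 3" by (rule power2_le_imp_le) simp
    then show ?thesis using r by (simp add: add_increasing)
  next
    \<comment> \<open>Now y' <= y + 1 <= 2 y. The value 4 r passes the test of
      \<open>rsol_le\<close> for the truncated data since exp (4 r) >= exp r and a'^2 <= a^2, and
      the product of the two factors 4 is the square of the factor 4 claimed.\<close>
    case False
    have y': "y'\<^sup>2 \<le> (2 * y)\<^sup>2" using False assms by (intro power_mono) auto
    have "r' \<le> 4 * r"
      unfolding defs(3)
    proof (rule rsol_le[OF a'])
      have "y'\<^sup>2 \<le> 4 * (r * S\<^sup>2)" using y' r(5) by (simp add: power_mult_distrib)
      also have "\<dots> = 4 * r * (exp r - a\<^sup>2)" using r(7) by simp
      also have "\<dots> \<le> 4 * r * (exp (4 * r) - a'\<^sup>2)"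
        using r(1) a2(1) by (intro mult_left_mono diff_mono) auto
      finally show "y'\<^sup>2 \<le> 4 * r * (exp (4 * r) - a'\<^sup>2)" .
    qed (use r in auto)
    then have "(r' * S')\<^sup>2 \<le> (4 * r) * (2 * y)\<^sup>2"
      unfolding sq using y' r(1,2) by (intro mult_mono) auto
    also have "\<dots> = (4 * (r * S))\<^sup>2" unfolding power_mult_distrib[of 4] sq by (simp add: power_mult_distrib)
    finally have "r' * S' \<le> 4 * (r * S)" by (rule power2_le_imp_le) (use r in simp)
    then show ?thesis by simp
  qed
  have S': "S' \<le> 3 + r' * S'"
  proof (cases "r' \<le> 1")
    case True
    then have "exp r' \<le> 3" by (intro order_trans[OF _ e1]) simp
    then have "S'\<^sup>2 \<le> 9" using r(8) zero_le_power2[of a'] by linarith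
    then have "S'\<^sup>2 \<le> 3\<^sup>2" by simp
    then have "S' \<le> 3" by (rule power2_le_imp_le) simp
    then show ?thesis using r by (simp add: add_increasing2)
  next
    case False
    then have "1 * S' \<le> r' * S'" using r by (intro mult_right_mono) auto
    then show ?thesis by simp
  qed
  have P: "r * S \<le> 6 + 2 * pi + 2 * \<bar>bellman a (y\<^sup>2)\<bar>"
  proof (cases "r \<le> 2")
    case True
    then have "exp r \<le> 9" by (intro order_trans[OF _ e2]) simp
    then have "S\<^sup>2 \<le> 9" using r(7) zero_le_power2[of a] by linarith
    then have "S\<^sup>2 \<le> 3\<^sup>2" by simp
    then have "S \<le> 3" by (rule power2_le_imp_le) simp
    then have "r * S \<le> 2 * 3" using True r by (intro mult_mono) auto
    then show ?thesis by (simp add: add_increasing2)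
  next
    \<comment> \<open>For r > 2 one has S <= r S / 2, so M <= pi - r S / 2: a large P makes M very
      negative.\<close>
    case False
    then have "2 * S \<le> r * S" using r by (intro mult_right_mono) auto
    moreover have "bellman a (y\<^sup>2) = a * angle_sol a (y\<^sup>2) + S - r * S"
      by (simp add: bellman_def defs algebra_simps)
    ultimately show ?thesis
      using ang(1) abs_ge_self[of "a * angle_sol a (y\<^sup>2)"] abs_ge_minus_self[of "bellman a (y\<^sup>2)"]
      by linarith
  qed
  have "bellman a' (y'\<^sup>2) = a' * angle_sol a' (y'\<^sup>2) + S' - r' * S'"
    by (simp add: bellman_def defs algebra_simps)
  then have "\<bar>bellman a' (y'\<^sup>2)\<bar> \<le> pi + S' + r' * S'"
    using abs_le_D1[OF ang(2)] abs_le_D2[OF ang(2)] r(4) mult_nonneg_nonneg[OF r(2) less_imp_le[OF r(4)]]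
    unfolding abs_le_iff by linarith
  then show ?thesis using S' P P' by linarith
qed

text \<open>Only r <= 1 can make the second term positive, and there S is bounded. This makes the
  positive part of the integrand integrable and so excludes the value \<infinity> - \<infinity> in
  the theorem.\<close>

lemma bellman_le:
  assumes "\<bar>a\<bar> < 1" "0 \<le> w"
  shows "bellman a w \<le> pi + 3"
proof -
  have "a * angle_sol a w \<le> 1 * pi"
    using assms angle_sol_bounds[OF assms] by (intro mult_mono) auto
  moreover have "(1 - rsol a w) * ssol a w \<le> 3"
  proof (cases "rsol a w \<le> 1")
    case True
    then have "exp (rsol a w) \<le> 3" by (intro order_trans[OF _ exp_le]) simp
    then have "(ssol a w)\<^sup>2 \<le> 9"
      using ssol_eq(2)[OF assms] zero_le_power2[of a] by linarith
    then have "(ssol a w)\<^sup>2 \<le> 3\<^sup>2" by simp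
    then have "ssol a w \<le> 3" by (rule power2_le_imp_le) simp
    then have "(1 - rsol a w) * ssol a w \<le> 1 * 3"
      using rsol_eq(1)[OF assms] ssol_eq(1)[OF assms] by (intro mult_mono) auto
    then show ?thesis by simp
  next
    case False
    then have "(1 - rsol a w) * ssol a w \<le> 0"
      using ssol_eq(1)[OF assms] by (intro mult_nonpos_nonneg) auto
    then show ?thesis by simp
  qed
  ultimately show ?thesis unfolding bellman_def by simp
qed

lemma bellman_zero:
  assumes "\<bar>m\<bar> < 1"
  shows "bellman m 0 = m * arccos (- m) + sqrt (1 - m\<^sup>2)"
  using rsol_zero[OF assms] by (simp add: bellman_def angle_sol_def ssol_def)

lemma borel_measurable_gaussian_measure [simp]:
  "borel_measurable gaussian_measure = borel_measurable borel"
  by (rule measurable_cong_sets) simp_all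

theorem mainTheorem3:
  fixes f :: "real ^ 'n \<Rightarrow> real"
  assumes "smooth f"
    and "\<And>x. - 1 < f x \<and> f x < 1"
  defines "r \<equiv> radial_sol f"
    and "m \<equiv> (\<integral>x. f x \<partial>gaussian_measure)"
  shows "extended_integral gaussian_measure
           (\<lambda>x. f x * arccos (- f x * exp (- r x / 2))
                + (1 - r x) * sqrt (exp (r x) - (f x)\<^sup>2))
         \<le> ereal (m * arccos (- m) + sqrt (1 - m\<^sup>2))"
proof -
  interpret prob_space "gaussian_measure :: (real ^ 'n) measure" by (rule prob_space_gaussian)
  define F where "F x = bellman (f x) ((norm (gradient f x))\<^sup>2)" for x
  have F_eq: "(\<lambda>x. f x * arccos (- f x * exp (- r x / 2)) + (1 - r x) * sqrt (exp (r x) - (f x)\<^sup>2)) = F"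
    by (simp add: fun_eq_iff F_def r_def radial_sol_eq_rsol bellman_def angle_sol_def ssol_def)
  have f1: "\<bar>f x\<bar> < 1" for x using assms(2)[of x] by auto
  have td: "times_differentiable k f" for k using assms(1) by (simp add: smooth_def)
  have diff: "f differentiable (at x)" for x using td[of 1] by simp
  have cont_f: "continuous_on UNIV f" using td[of 0] by simp
  have cont_F: "continuous_on UNIV F"
  proof -
    have "continuous_on UNIV (\<lambda>x. frechet_derivative f (at x) (axis j 1))" for j
      using td[of 1] by simp
    then show ?thesis
      unfolding F_def by (intro continuous_on_sol cont_f f1) (auto simp: power2_norm_gradient[OF diff] intro!: continuous_intros sum_nonneg)
  qed
  have [measurable]: "f \<in> borel_measurable borel" "F \<in> borel_measurable borel"
    using cont_f cont_F by (auto intro: borel_measurable_continuous_onI)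

  have integrable_case: "(\<integral>x. F x \<partial>gaussian_measure) \<le> m * arccos (- m) + sqrt (1 - m\<^sup>2)"
    if int: "integrable gaussian_measure F"
  proof -
    \<comment> \<open>The offset 8 makes every radius admissible for
      \<open>norm_gradient_cutoff\<close>.\<close>
    define R where "R n = real n + 8" for n
    have R: "8 \<le> R n" "0 < R n" for n by (auto simp: R_def)
    have R_lim: "(\<lambda>n. 1 / (R n)\<^sup>2) \<longlonglongrightarrow> 0"
      unfolding R_def by real_asymp
    define g where "g n x = f x * cutoff (R n) x" for n x
    define c where "c n x = - 8 / (R n)\<^sup>2 * max 0 (1 - (norm x)\<^sup>2 / (R n)\<^sup>2) ^ 3" for n and x :: "real^'n"
    define D where "D n x = f x *\<^sub>R (c n x *\<^sub>R x) + cutoff (R n) x *\<^sub>R gradient f x" for n x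
    have gD: "GDERIV (g n) x :> D n x" for n x
      unfolding g_def D_def c_def by (intro GDERIV_mult GDERIV_cutoff gderiv_gradient diff)
    have cut_lim: "(\<lambda>n. cutoff (R n) x) \<longlonglongrightarrow> 1" for x :: "real^'n"
    proof -
      have "(\<lambda>n. max 0 (1 - (norm x)\<^sup>2 * (1 / (R n)\<^sup>2)) ^ 4) \<longlonglongrightarrow> max 0 (1 - (norm x)\<^sup>2 * 0) ^ 4"
        by (intro tendsto_intros R_lim)
      then show ?thesis by (simp add: cutoff_def)
    qed
    have c_lim: "(\<lambda>n. c n x) \<longlonglongrightarrow> 0" for x
    proof -
      have "(\<lambda>n. - 8 * (1 / (R n)\<^sup>2) * max 0 (1 - (norm x)\<^sup>2 * (1 / (R n)\<^sup>2)) ^ 3) \<longlonglongrightarrow>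
          - 8 * 0 * max 0 (1 - (norm x)\<^sup>2 * 0) ^ 3"
        by (intro tendsto_intros R_lim)
      then show ?thesis by (simp add: c_def)
    qed
    have g_lim: "(\<lambda>n. g n x) \<longlonglongrightarrow> f x" for x
      unfolding g_def using tendsto_mult[OF tendsto_const cut_lim, of "f x" x] by simp
    have D_lim: "(\<lambda>n. D n x) \<longlonglongrightarrow> gradient f x" for x
    proof -
      have "(\<lambda>n. D n x) \<longlonglongrightarrow> f x *\<^sub>R (0 *\<^sub>R x) + 1 *\<^sub>R gradient f x"
        unfolding D_def by (intro tendsto_intros c_lim cut_lim)
      then show ?thesis by simp
    qed
    have g_le: "\<bar>g n x\<bar> \<le> \<bar>f x\<bar>" for n x
      using mult_left_mono[OF cutoff_bounds(2)[of "R n" x], of "\<bar>f x\<bar>"] cutoff_bounds(1)[of "R n" x]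
      by (simp add: g_def abs_mult)
    have D_le: "norm (D n x) \<le> norm (gradient f x) + 1" for n x
    proof -
      have "norm (c n x *\<^sub>R x) \<le> 1"
        unfolding c_def by (rule norm_gradient_cutoff[OF R(1)])
      then have "\<bar>f x\<bar> * norm (c n x *\<^sub>R x) \<le> 1 * 1"
        using f1[of x] by (intro mult_mono) auto
      moreover have "\<bar>cutoff (R n) x\<bar> * norm (gradient f x) \<le> 1 * norm (gradient f x)"
        using cutoff_bounds[of "R n" x] by (intro mult_right_mono) auto
      ultimately show ?thesis
        unfolding D_def by (intro order_trans[OF norm_triangle_ineq]) (simp add: abs_mult mult.assoc)
    qed
    have g_diff: "g n differentiable (at x)" for n x
      using gD[of n x] unfolding gderiv_def differentiable_def by blast
    define M where "M n = (\<integral>x. g n x \<partial>gaussian_measure)" for n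
    define h where "h n x = bellman (g n x) ((norm (D n x))\<^sup>2)" for n x
    have step: "h n \<in> borel_measurable borel \<and> 
        (\<integral>x. h n x \<partial>gaussian_measure) \<le> M n * arccos (- M n) + sqrt (1 - (M n)\<^sup>2)" for n
    proof -
      \<comment> \<open>The order is written with successors because
        \<open>bounded_C1_compact_support\<close> removes one at each of its three
        applications.\<close>
      have td3: "times_differentiable (Suc (Suc (Suc 0))) (g n)"
        using times_differentiable_mult[OF td times_differentiable_cutoff, of "R n"]
        by (simp only: g_def[abs_def] numeral_3_eq_3)
      have supp: "g n x = 0" if "x \<notin> cball 0 (R n)" for x
        using cutoff_eq_0[OF R(2) that] by (simp add: g_def)
      note s1 = bounded_C1_compact_support[OF td3 supp]
      note s2 = bounded_C1_compact_support[OF s1(2) s1(3)]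
      note s3 = bounded_C1_compact_support[OF s2(2) s2(3)]
      define g1 where "g1 j x = frechet_derivative (g n) (at x) (axis j 1)" for j x
      have h_eq: "h n x = bellman (g n x) (\<Sum>j\<in>UNIV. (g1 j x)\<^sup>2)" for x
        using power2_norm_gradient[OF g_diff] gradient_eqI[OF gD] by (simp add: h_def g1_def)
      have g1': "\<bar>g n x\<bar> < 1" for x using g_le[of n x] f1[of x] by linarith
      \<comment> \<open>This is where compact support supplies the uniform bound: f may approach 1
        or -1 at infinity, but |g n| attains its maximum, and that value is below 1.\<close>
      have "\<exists>c0<1. \<forall>x. \<bar>g n x\<bar> \<le> c0"
      proof -
        have "compact (cball (0::real^'n) (R n))" "cball (0::real^'n) (R n) \<noteq> {}"
          using R(2)[of n] by auto
        moreover have "continuous_on (cball 0 (R n)) (\<lambda>x. \<bar>g n x\<bar>)"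
          using g_diff by (intro continuous_intros continuous_at_imp_continuous_on)
            (blast intro: differentiable_imp_continuous_within)
        ultimately obtain z where z: "\<And>x. x \<in> cball 0 (R n) \<Longrightarrow> \<bar>g n x\<bar> \<le> \<bar>g n z\<bar>"
          using continuous_attains_sup by metis
        have "\<bar>g n x\<bar> \<le> \<bar>g n z\<bar>" for x
          using z[of x] supp[of x] by (cases "x \<in> cball 0 (R n)") auto
        then show ?thesis using g1' by blast
      qed
      then obtain c0 where c0: "c0 < 1" "\<And>x. \<bar>g n x\<bar> \<le> c0" by blast
      have "(\<integral>x. h n x \<partial>gaussian_measure) \<le> bellman (M n) 0"
        unfolding h_eq M_def g1_def
        by (rule bellman_gaussian_inequality[OF s1(1) s2(1) s3(1) c0(2) c0(1)])
      moreover have "\<bar>M n\<bar> < 1"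
      proof -
        have "\<bar>M n\<bar> \<le> c0"
          using abs_mehler_le[of "g n" c0 "pi / 2" 0] c0(2) bounded_C1D(1)[OF s1(1)]
          by (simp add: M_def mehler_pi_half borel_measurable_continuous_onI)
        then show ?thesis using c0(1) by linarith
      qed
      moreover have "continuous_on UNIV (h n)"
        unfolding h_eq[abs_def] g1_def using bounded_C1D(1,2)[OF s1(1)]
        by (intro continuous_on_sol(4) g1' sum_nonneg) (auto intro!: continuous_intros)
      ultimately show ?thesis
        by (simp add: bellman_zero borel_measurable_continuous_onI)
    qed
    have hl: "(\<lambda>n. \<integral>x. h n x \<partial>gaussian_measure) \<longlonglongrightarrow> (\<integral>x. F x \<partial>gaussian_measure)"
    proof (rule integral_dominated_convergence[where w="\<lambda>x. 57 + 17 * pi + 16 * \<bar>F x\<bar>"])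
      show "integrable gaussian_measure (\<lambda>x. 57 + 17 * pi + 16 * \<bar>F x\<bar>)"
        using int by simp
      have "(\<lambda>n. h n x) \<longlonglongrightarrow> F x" for x
        unfolding h_def F_def
        by (intro tendsto_bellman g_lim tendsto_intros D_lim f1) auto
      then show "AE x in gaussian_measure. (\<lambda>n. h n x) \<longlonglongrightarrow> F x" by simp
      have "\<bar>h n x\<bar> \<le> 57 + 17 * pi + 16 * \<bar>F x\<bar>" for n x
        unfolding h_def F_def by (rule bellman_growth) (use f1 g_le D_le in auto)
      then show "AE x in gaussian_measure. norm (h n x) \<le> 57 + 17 * pi + 16 * \<bar>F x\<bar>" for n by simp
      show "h n \<in> borel_measurable gaussian_measure" for n
        using step[of n] by simp
    qed simp
    have Ml: "M \<longlonglongrightarrow> m"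
      unfolding M_def m_def
    proof (rule integral_dominated_convergence[where w="\<lambda>_. 1"])
      have "\<bar>g n x\<bar> \<le> 1" for n x using g_le[of n x] f1[of x] by linarith
      then show "AE x in gaussian_measure. norm (g n x) \<le> 1" for n by simp
      show "g n \<in> borel_measurable gaussian_measure" for n
        using g_diff by (auto intro!: borel_measurable_continuous_onI continuous_at_imp_continuous_on
            differentiable_imp_continuous_within)
    qed (use g_lim in auto)
    \<comment> \<open>The closed interval suffices for the limit, since the right-hand side is
      continuous up to -1 and 1.\<close>
    have bounds: "M n \<in> {-1..1}" "m \<in> {-1..1}" for n
    proof -
      have *: "\<bar>\<integral>x. k x \<partial>gaussian_measure\<bar> \<le> 1" if "k \<in> borel_measurable borel" "\<And>x. \<bar>k x\<bar> \<le> 1" for k :: "real^'n \<Rightarrow> real"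
        using abs_mehler_le[OF that, of "pi / 2" 0] by (simp add: mehler_pi_half)
      have "\<bar>m\<bar> \<le> 1"
        unfolding m_def by (rule *) (auto intro: less_imp_le[OF f1])
      then show "m \<in> {-1..1}" by auto
      have "g n \<in> borel_measurable borel"
        using g_diff by (auto intro!: borel_measurable_continuous_onI continuous_at_imp_continuous_on
            differentiable_imp_continuous_within)
      moreover have "\<bar>g n x\<bar> \<le> 1" for x using g_le[of n x] f1[of x] by linarith
      ultimately have "\<bar>M n\<bar> \<le> 1" unfolding M_def by (rule *)
      then show "M n \<in> {-1..1}" by auto
    qed
    have "continuous_on {-1..1} (\<lambda>u. u * arccos (- u) + sqrt (1 - u\<^sup>2))"
      by (intro continuous_intros) auto
    from continuous_on_tendsto_compose[OF this Ml] bounds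
    have "(\<lambda>n. M n * arccos (- M n) + sqrt (1 - (M n)\<^sup>2)) \<longlonglongrightarrow> m * arccos (- m) + sqrt (1 - m\<^sup>2)"
      by auto
    from LIMSEQ_le[OF hl this] step show ?thesis by blast
  qed

  have pos: "(\<integral>\<^sup>+x. ennreal (F x) \<partial>gaussian_measure) < \<infinity>"
  proof -
    have "(\<integral>\<^sup>+x. ennreal (F x) \<partial>gaussian_measure) \<le> (\<integral>\<^sup>+x. ennreal (pi + 3) \<partial>(gaussian_measure :: (real^'n) measure))"
      using bellman_le[OF f1] by (intro nn_integral_mono ennreal_leI) (auto simp: F_def)
    also have "\<dots> < \<infinity>" using emeasure_space_1 by simp
    finally show ?thesis .
  qed
  show ?thesis
    unfolding F_eq
  proof (cases "(\<integral>\<^sup>+x. ennreal (- F x) \<partial>gaussian_measure) = \<infinity>")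
    \<comment> \<open>The positive part has a finite integral, so the difference is a genuine minus
      infinity.\<close>
    case True
    obtain u where "(\<integral>\<^sup>+x. ennreal (F x) \<partial>gaussian_measure) = ennreal u" "0 \<le> u"
      using pos by (cases "\<integral>\<^sup>+x. ennreal (F x) \<partial>gaussian_measure") auto
    then have "extended_integral gaussian_measure F = - \<infinity>"
      unfolding extended_integral_def True by simp
    then show "extended_integral gaussian_measure F \<le> ereal (m * arccos (- m) + sqrt (1 - m\<^sup>2))" by simp
  next
    case False
    then have "integrable gaussian_measure F"
      using pos by (simp add: real_integrable_def)
    then show "extended_integral gaussian_measure F \<le> ereal (m * arccos (- m) + sqrt (1 - m\<^sup>2))"
      using integrable_case by (simp add: extended_integral_eq_integral)
  qed
qed

end
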